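(* Let $D$ be a logarithmic tract of $f$. Then for every sufficiently large $\rho>0$, the closure of $$A'(f,D)=\{z\in D:\ \exists L\in\mathbb{N}\text{ such that } f^n(z)\in D\text{ and }|f^{n+L}(z)|\ge M_D^n(\rho)\text{ for all }n\in\mathbb{N}\}$$ has Hausdorff dimension strictly greater than $1$.
   Context: A direct tract of $f$: $D$ is an unbounded domain in $\mathbb{C}$ whose boundary consists of piecewise smooth curves and whose complement is unbounded; $f$ is defined on $\overline D$, holomorphic in $D$, continuous on $\overline D$, and there is $R>0$ with $|f|=R$ on $\partial D$ and $|f|>R$ in $D$. It is a logarithmic tract if moreover $f:D\to\{z:|z|>R\}$ is a universal covering. $M_D(r)=\max_{|z|=r,z\in D}|f(z)|$ and $M_D^n$ is its $n$-th iterate. (The set $A'(f,D)$ does not depend on $\rho$ once $\rho$ is sufficiently large.) *)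

theory Defs
  imports "HOL-Complex_Analysis.Complex_Analysis"
begin

definition hausdorff_pre :: "real \<Rightarrow> real \<Rightarrow> complex set \<Rightarrow> ennreal" where
  "hausdorff_pre s \<delta> E =
     (INF U \<in> {U :: nat \<Rightarrow> complex set. E \<subseteq> (\<Union>i. U i) \<and>
                  (\<forall>i. bounded (U i) \<and> diameter (U i) \<le> \<delta>)}.
        (\<Sum>i. ennreal (diameter (U i) powr s)))"

definition hausdorff_measure :: "real \<Rightarrow> complex set \<Rightarrow> ennreal" where
  "hausdorff_measure s E = (SUP \<delta> \<in> {0<..}. hausdorff_pre s \<delta> E)"

definition hausdorff_dim :: "complex set \<Rightarrow> ereal" where
  "hausdorff_dim E = Inf {ereal s | s. 0 \<le> s \<and> hausdorff_measure s E = 0}"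

definition piecewise_smooth_boundary :: "complex set \<Rightarrow> bool" where
  "piecewise_smooth_boundary D \<longleftrightarrow>
     (\<exists>C :: (real \<Rightarrow> complex) set. countable C \<and>
        (\<forall>\<gamma>\<in>C. \<forall>a b. a \<le> b \<longrightarrow> \<gamma> piecewise_C1_differentiable_on {a..b}) \<and>
        frontier D = (\<Union>\<gamma>\<in>C. range \<gamma>))"

definition direct_tract :: "(complex \<Rightarrow> complex) \<Rightarrow> complex set \<Rightarrow> real \<Rightarrow> bool" where
  "direct_tract f D R \<longleftrightarrow>
     open D \<and> connected D \<and> D \<noteq> {} \<and> \<not> bounded D \<and> \<not> bounded (- D) \<and>
     piecewise_smooth_boundary D \<and>
     continuous_on (closure D) f \<and> f holomorphic_on D \<and>
     R > 0 \<and> (\<forall>z\<in>frontier D. norm (f z) = R) \<and> (\<forall>z\<in>D. norm (f z) > R)"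

text \<open>Universal covering = covering map with simply connected (connected) total space.\<close>
definition logarithmic_tract :: "(complex \<Rightarrow> complex) \<Rightarrow> complex set \<Rightarrow> real \<Rightarrow> bool" where
  "logarithmic_tract f D R \<longleftrightarrow>
     direct_tract f D R \<and> covering_space D f {w. norm w > R} \<and> simply_connected D"

definition M_D :: "(complex \<Rightarrow> complex) \<Rightarrow> complex set \<Rightarrow> real \<Rightarrow> real" where
  "M_D f D r = Sup {norm (f z) | z. z \<in> D \<and> norm z = r}"

definition A' :: "(complex \<Rightarrow> complex) \<Rightarrow> complex set \<Rightarrow> real \<Rightarrow> complex set" where
  "A' f D \<rho> = {z \<in> D. \<exists>L::nat. \<forall>n::nat.
       (f ^^ n) z \<in> D \<and> norm ((f ^^ (n + L)) z) \<ge> (M_D f D ^^ n) \<rho>}"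

end

theory Submission
  imports Defs
begin

text \<open>Since \<open>D\<close> is simply connected, \<open>f\<close> is \<open>exp\<close> composed with the inverse of a conformal map \<open>\<phi>\<close>
  of a right half-plane onto \<open>D\<close>. In logarithmic coordinates the inverse branches of \<open>f\<close> are
  \<open>u \<mapsto> \<Phi> (u + 2 \<pi> i k)\<close> with \<open>\<Phi> = log \<phi>\<close>. As \<open>exp \<circ> \<Phi>\<close> is injective, Bloch's theorem bounds
  \<open>\<bar>\<Phi>'\<bar>\<close> by a multiple of the reciprocal distance to the boundary. On a rectangle of width \<open>b/8\<close>
  at distance about \<open>b\<close> from the boundary, distortion is therefore bounded and images have bounded
  diameter, while \<open>\<Phi>\<close> maps the vertical line \<open>Re = b\<close> to a curve that crosses the rectangle
  horizontally. So finitely many branches map the rectangle into itself (modulo \<open>2 \<pi> i\<close>) with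
  disjoint images and lower Lipschitz constants whose sum is at least a multiple of \<open>b\<close>, hence
  exceeds 1. The set \<open>A'\<close> is backward invariant, so its closure is preserved by the branches; and
  it meets the rectangle, as one sees by pulling back discs centred near points where \<open>M_D\<close> is attained.
  A compact set carrying such a system of branches has dimension greater than 1.\<close>

section \<open>Sets with expanding inverse branches\<close>

lemma diameter_le_of_dist:
  fixes S :: "'a::metric_space set"
  assumes "0 \<le> d" "\<And>x y. x \<in> S \<Longrightarrow> y \<in> S \<Longrightarrow> dist x y \<le> d"
  shows "bounded S" "diameter S \<le> d"
proof -
  show "bounded S"
    using assms(2) by (auto simp: bounded_two_points)
  show "diameter S \<le> d"
    unfolding diameter_def using assms by (auto intro!: cSUP_least)
qed

text \<open>Induction on the size of the cover: sets smaller than the gap \<open>\<delta>\<close> meet only one of the pieces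
  \<open>G k ` X\<close>, so the cover splits into disjoint covers of the pieces, each of which pulls back to
  a smaller cover of \<open>X\<close>. No measure on \<open>X\<close> is needed.\<close>

lemma finite_cover_sum_ge:
  fixes X :: "'a::metric_space set" and G :: "'k \<Rightarrow> 'a \<Rightarrow> 'a" and U :: "'i \<Rightarrow> 'a set"
  assumes K: "finite K" "2 \<le> card K" and "X \<noteq> {}"
    and maps: "\<And>k. k \<in> K \<Longrightarrow> G k ` X \<subseteq> X"
    and c_pos: "\<And>k. k \<in> K \<Longrightarrow> 0 < c k"
    and expand: "\<And>k x y. k \<in> K \<Longrightarrow> x \<in> X \<Longrightarrow> y \<in> X \<Longrightarrow> c k * dist x y \<le> dist (G k x) (G k y)"
    and "0 < \<delta>"
    and gap: "\<And>k l x y. k \<in> K \<Longrightarrow> l \<in> K \<Longrightarrow> k \<noteq> l \<Longrightarrow> x \<in> X \<Longrightarrow> y \<in> X \<Longrightarrow> \<delta> \<le> dist (G k x) (G l y)"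
    and "0 < s" and sum_c: "1 \<le> (\<Sum>k\<in>K. c k powr s)"
    and "finite I" "X \<subseteq> (\<Union>i\<in>I. U i)" "\<And>i. i \<in> I \<Longrightarrow> bounded (U i)"
  shows "\<delta> powr s \<le> (\<Sum>i\<in>I. diameter (U i) powr s)"
  using assms(11-)
proof (induction "card I" arbitrary: I U rule: less_induct)
  case less
  note cover = \<open>X \<subseteq> (\<Union>i\<in>I. U i)\<close> and bdd = \<open>\<And>i. i \<in> I \<Longrightarrow> bounded (U i)\<close>
  show ?case
  proof (cases "\<exists>i\<in>I. \<delta> \<le> diameter (U i)")
    case True
    then obtain i where i: "i \<in> I" "\<delta> \<le> diameter (U i)" by blast
    have "\<delta> powr s \<le> diameter (U i) powr s"
      using i \<open>0 < \<delta>\<close> \<open>0 < s\<close> by (intro powr_mono2) auto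
    also have "\<dots> \<le> (\<Sum>i\<in>I. diameter (U i) powr s)"
      using i \<open>finite I\<close> by (intro member_le_sum) auto
    finally show ?thesis .
  next
    case False
    define J where "J k = {i \<in> I. U i \<inter> G k ` X \<noteq> {}}" for k
    have J_fin: "finite (J k)" and J_sub: "J k \<subseteq> I" for k
      using \<open>finite I\<close> by (auto simp: J_def)
    have J_disj: "J k \<inter> J l = {}" if "k \<in> K" "l \<in> K" "k \<noteq> l" for k l
    proof (rule ccontr)
      assume "J k \<inter> J l \<noteq> {}"
      then obtain i x y where i: "i \<in> I" "x \<in> X" "y \<in> X" "G k x \<in> U i" "G l y \<in> U i"
        by (auto simp: J_def)
      have "\<delta> \<le> dist (G k x) (G l y)" using gap that i by blast
      also have "\<dots> \<le> diameter (U i)" using i bdd by (intro diameter_bounded_bound) auto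
      finally show False using False i by auto
    qed
    have J_ne: "J k \<noteq> {}" if "k \<in> K" for k
    proof -
      obtain x where "x \<in> X" using \<open>X \<noteq> {}\<close> by blast
      then have "G k x \<in> X" using maps that by blast
      then obtain i where "i \<in> I" "G k x \<in> U i" using cover by blast
      then show ?thesis using \<open>x \<in> X\<close> by (auto simp: J_def)
    qed
    have piece: "c k powr s * \<delta> powr s \<le> (\<Sum>i\<in>J k. diameter (U i) powr s)" if "k \<in> K" for k
    proof -
      \<comment> \<open>A second branch uses at least one covering set outside \<open>J k\<close>,
        so \<open>J k\<close> is a proper subset of \<open>I\<close> and the induction hypothesis
        applies to it.\<close>
      obtain l where l: "l \<in> K" "l \<noteq> k"
        using K that by (metis One_nat_def card_le_Suc0_iff_eq not_less_eq_eq numeral_2_eq_2)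
      have "J k \<subset> I"
        using J_sub J_ne[OF l(1)] J_disj[OF that l(1)] l(2) by fast
      then have card: "card (J k) < card I" using \<open>finite I\<close> by (rule psubset_card_mono[rotated])
      define V where "V i = {x \<in> X. G k x \<in> U i}" for i
      have V: "bounded (V i) \<and> diameter (V i) \<le> diameter (U i) / c k" if "i \<in> J k" for i
      proof -
        have "i \<in> I" using that J_sub by blast
        have "dist x y \<le> diameter (U i) / c k" if "x \<in> V i" "y \<in> V i" for x y
        proof -
          have "c k * dist x y \<le> dist (G k x) (G k y)"
            using expand \<open>k \<in> K\<close> that by (auto simp: V_def)
          also have "\<dots> \<le> diameter (U i)"
            using that bdd \<open>i \<in> I\<close> by (intro diameter_bounded_bound) (auto simp: V_def)
          finally show ?thesis using c_pos[OF \<open>k \<in> K\<close>] by (simp add: field_simps)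
        qed
        moreover have "0 \<le> diameter (U i) / c k"
          using c_pos[OF \<open>k \<in> K\<close>] diameter_ge_0[OF bdd[OF \<open>i \<in> I\<close>]] by simp
        ultimately show ?thesis using diameter_le_of_dist by metis
      qed
      have "\<delta> powr s \<le> (\<Sum>i\<in>J k. diameter (V i) powr s)"
      proof (rule less.hyps[OF card J_fin])
        show "X \<subseteq> (\<Union>i\<in>J k. V i)"
        proof
          fix x assume "x \<in> X"
          then have "G k x \<in> X" using maps that by blast
          then obtain i where "i \<in> I" "G k x \<in> U i" using cover by blast
          then show "x \<in> (\<Union>i\<in>J k. V i)" using \<open>x \<in> X\<close> by (auto simp: J_def V_def)
        qed
      qed (use V in auto)
      also have "\<dots> \<le> (\<Sum>i\<in>J k. (diameter (U i) / c k) powr s)"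
        using V \<open>0 < s\<close> by (intro sum_mono powr_mono2) (auto simp: diameter_ge_0)
      also have "\<dots> = (\<Sum>i\<in>J k. diameter (U i) powr s) / c k powr s"
        unfolding sum_divide_distrib
        using J_sub bdd c_pos[OF that] by (intro sum.cong) (auto simp: powr_divide diameter_ge_0 less_imp_le)
      finally show ?thesis using c_pos[OF that] by (simp add: field_simps)
    qed
    have "\<delta> powr s \<le> (\<Sum>k\<in>K. c k powr s) * \<delta> powr s"
      using sum_c by (simp add: mult_le_cancel_right1)
    also have "\<dots> = (\<Sum>k\<in>K. c k powr s * \<delta> powr s)" by (simp add: sum_distrib_right)
    also have "\<dots> \<le> (\<Sum>k\<in>K. \<Sum>i\<in>J k. diameter (U i) powr s)"
      by (intro sum_mono piece)
    also have "\<dots> = (\<Sum>i\<in>(\<Union>k\<in>K. J k). diameter (U i) powr s)"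
      using K J_fin J_disj by (intro sum.UNION_disjoint[symmetric]) auto
    also have "\<dots> \<le> (\<Sum>i\<in>I. diameter (U i) powr s)"
      using \<open>finite I\<close> J_sub by (intro sum_mono2) auto
    finally show ?thesis .
  qed
qed

text \<open>The sum is continuous in the exponent and exceeds 1 at exponent 1, so it still does
  slightly to the right. The strict inequality for the dimension comes from here.\<close>

lemma ex_exponent_gt_one:
  fixes c :: "'k \<Rightarrow> real"
  assumes "\<And>k. k \<in> K \<Longrightarrow> 0 < c k" and "1 < (\<Sum>k\<in>K. c k)"
  obtains s where "1 < s" "1 \<le> (\<Sum>k\<in>K. c k powr s)"
proof -
  have "((\<lambda>s. \<Sum>k\<in>K. c k powr s) \<longlongrightarrow> (\<Sum>k\<in>K. c k powr 1)) (at_right 1)"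
    using assms(1) by (intro tendsto_intros) (auto dest: less_imp_neq)
  moreover have "(\<Sum>k\<in>K. c k powr 1) = (\<Sum>k\<in>K. c k)"
    using assms(1) by (intro sum.cong) (auto simp: less_imp_le)
  ultimately have "eventually (\<lambda>s. 1 < (\<Sum>k\<in>K. c k powr s)) (at_right 1)"
    using assms(2) by (metis order_tendstoD(1))
  moreover have "eventually (\<lambda>s. 1 < s) (at_right (1::real))"
    by (simp add: eventually_at_right_less)
  ultimately have "eventually (\<lambda>s. 1 < s \<and> 1 < (\<Sum>k\<in>K. c k powr s)) (at_right 1)"
    by eventually_elim auto
  then obtain s where "1 < s" "1 < (\<Sum>k\<in>K. c k powr s)"
    using eventually_happens trivial_limit_at_right_real by blast
  then show thesis by (intro that less_imp_le)
qed

section \<open>From lower bounds for covers to Hausdorff dimension\<close>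

text \<open>At scale 1 all covering sets have diameter at most 1, so raising the exponent lowers
  each term.\<close>

lemma hausdorff_pre_mono_exponent:
  assumes "s \<le> t"
  shows "hausdorff_pre t 1 E \<le> hausdorff_pre s 1 E"
  unfolding hausdorff_pre_def
proof (rule INF_mono, clarify)
  fix U :: "nat \<Rightarrow> complex set"
  assume U: "E \<subseteq> (\<Union>i. U i)" "\<forall>i. bounded (U i) \<and> diameter (U i) \<le> 1"
  show "\<exists>V\<in>{V. E \<subseteq> (\<Union>i. V i) \<and> (\<forall>i. bounded (V i) \<and> diameter (V i) \<le> 1)}.
          (\<Sum>i. ennreal (diameter (V i) powr t)) \<le> (\<Sum>i. ennreal (diameter (U i) powr s))"
  proof (rule bexI[of _ U])
    show "(\<Sum>i. ennreal (diameter (U i) powr t)) \<le> (\<Sum>i. ennreal (diameter (U i) powr s))"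
      using U assms by (intro suminf_le ennreal_leI powr_mono') (auto simp: diameter_ge_0)
  qed (use U in auto)
qed

text \<open>A bound at scale 1 is enough: pre-measures at exponents below \<open>s\<close> are at
  least as large, so none of these exponents has measure zero and the infimum is at least
  \<open>s\<close>.\<close>

lemma hausdorff_dim_gt_oneI:
  assumes "1 < s" "0 < \<kappa>"
    and "\<And>U :: nat \<Rightarrow> complex set. E \<subseteq> (\<Union>i. U i) \<Longrightarrow> (\<And>i. bounded (U i)) \<Longrightarrow>
           ennreal \<kappa> \<le> (\<Sum>i. ennreal (diameter (U i) powr s))"
  shows "hausdorff_dim E > 1"
proof -
  have pre: "ennreal \<kappa> \<le> hausdorff_pre s 1 E"
    unfolding hausdorff_pre_def using assms(3) by (intro INF_greatest) auto
  have "ereal s \<le> hausdorff_dim E"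
    unfolding hausdorff_dim_def
  proof (rule Inf_greatest, clarify)
    fix t assume t: "0 \<le> t" "hausdorff_measure t E = 0"
    show "ereal s \<le> ereal t"
    proof (rule ccontr)
      assume "\<not> ereal s \<le> ereal t"
      then have "hausdorff_pre s 1 E \<le> hausdorff_pre t 1 E"
        by (intro hausdorff_pre_mono_exponent) auto
      also have "\<dots> \<le> hausdorff_measure t E"
        unfolding hausdorff_measure_def by (rule SUP_upper) auto
      finally show False using pre t \<open>0 < \<kappa>\<close> by (simp add: ennreal_eq_0_iff)
    qed
  qed
  moreover have "1 < ereal s" using \<open>1 < s\<close> by simp
  ultimately show ?thesis by (rule order_less_le_trans[rotated])
qed

text \<open>Serves to thicken the sets of a cover to open ones, so that compactness applies, at
  arbitrarily small cost in the sum.\<close>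

lemma ex_enlargement:
  fixes d :: real
  assumes "0 \<le> d" "0 < s" "0 < \<epsilon>"
  obtains e where "0 < e" "(d + 2 * e) powr s \<le> d powr s + \<epsilon>"
proof -
  have "((\<lambda>e. (d + 2 * e) powr s) \<longlongrightarrow> (d + 2 * 0) powr s) (at_right 0)"
    using assms by (intro tendsto_powr' tendsto_intros) (auto simp: eventually_at_right_less intro!: eventually_at_right_less[THEN eventually_mono])
  then have "eventually (\<lambda>e. (d + 2 * e) powr s < d powr s + \<epsilon>) (at_right 0)"
    using assms(3) by (intro order_tendstoD(2)) auto
  moreover have "eventually (\<lambda>e. 0 < e) (at_right (0::real))"
    by (simp add: eventually_at_right_less)
  ultimately have "eventually (\<lambda>e. 0 < e \<and> (d + 2 * e) powr s < d powr s + \<epsilon>) (at_right 0)"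
    by eventually_elim auto
  then obtain e where "0 < e" "(d + 2 * e) powr s < d powr s + \<epsilon>"
    using eventually_happens trivial_limit_at_right_real by blast
  then show thesis by (intro that less_imp_le)
qed

text \<open>Compactness turns disjointness of the branches into a positive gap and a countable open
  cover into a finite one. Covers of \<open>E\<close> are pulled back to \<open>X\<close> by
  \<open>h\<close>, separately on each \<open>P j\<close>, and \<open>finite_cover_sum_ge\<close>
  bounds the result from below.\<close>

lemma hausdorff_dim_expanding_image_gt_one:
  fixes X E :: "complex set" and G :: "'k \<Rightarrow> complex \<Rightarrow> complex" and h :: "complex \<Rightarrow> complex"
  assumes K: "finite K" "2 \<le> card K" and X: "compact X" "X \<noteq> {}"
    and maps: "\<And>k. k \<in> K \<Longrightarrow> G k ` X \<subseteq> X"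
    and cont: "\<And>k. k \<in> K \<Longrightarrow> continuous_on X (G k)"
    and c_pos: "\<And>k. k \<in> K \<Longrightarrow> 0 < c k"
    and expand: "\<And>k x y. k \<in> K \<Longrightarrow> x \<in> X \<Longrightarrow> y \<in> X \<Longrightarrow> c k * dist x y \<le> dist (G k x) (G k y)"
    and disj: "\<And>k l. k \<in> K \<Longrightarrow> l \<in> K \<Longrightarrow> k \<noteq> l \<Longrightarrow> G k ` X \<inter> G l ` X = {}"
    and sum_c: "1 < (\<Sum>k\<in>K. c k)"
    and h: "continuous_on X h" "h ` X \<subseteq> E"
    and J: "finite J" "X \<subseteq> (\<Union>j\<in>J. P j)" and "0 < b"
    and h_expand: "\<And>j x y. j \<in> J \<Longrightarrow> x \<in> X \<inter> P j \<Longrightarrow> y \<in> X \<inter> P j \<Longrightarrow> b * dist x y \<le> dist (h x) (h y)"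
  shows "hausdorff_dim E > 1"
proof -
  obtain s where s: "1 < s" "1 \<le> (\<Sum>k\<in>K. c k powr s)"
    using ex_exponent_gt_one c_pos sum_c by metis
  have cmp: "compact (G k ` X)" if "k \<in> K" for k
    using X cont that by (intro compact_continuous_image) auto
  have "\<exists>\<delta>>0. \<forall>k\<in>K. \<forall>l\<in>K. k \<noteq> l \<longrightarrow> (\<forall>x\<in>X. \<forall>y\<in>X. \<delta> \<le> dist (G k x) (G l y))"
  proof -
    define D where "D = (\<lambda>(k,l). setdist (G k ` X) (G l ` X)) ` {(k,l) \<in> K \<times> K. k \<noteq> l}"
    have D: "finite D" unfolding D_def using K by (intro finite_imageI) (auto intro: finite_subset[of _ "K \<times> K"])
    have pos: "0 < setdist (G k ` X) (G l ` X)" if "k \<in> K" "l \<in> K" "k \<noteq> l" for k l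
      using setdist_gt_0_compact_closed[OF cmp[OF that(1)] compact_imp_closed[OF cmp[OF that(2)]]]
        X(2) disj[OF that] by simp
    \<comment> \<open>The inserted \<open>1\<close> makes the set visibly nonempty, as
      \<open>Min\<close> requires.\<close>
    define \<delta> where "\<delta> = Min (insert 1 D)"
    have "0 < \<delta>" unfolding \<delta>_def using D pos by (subst Min_gr_iff) (auto simp: D_def)
    moreover have "\<delta> \<le> dist (G k x) (G l y)" if "k \<in> K" "l \<in> K" "k \<noteq> l" "x \<in> X" "y \<in> X" for k l x y
    proof -
      have "\<delta> \<le> setdist (G k ` X) (G l ` X)"
        unfolding \<delta>_def using D that by (intro Min_le) (auto simp: D_def)
      also have "\<dots> \<le> dist (G k x) (G l y)" using that by (intro setdist_le_dist) auto
      finally show ?thesis .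
    qed
    ultimately show ?thesis by blast
  qed
  then obtain \<delta> where "0 < \<delta>"
    and gap: "\<And>k l x y. k \<in> K \<Longrightarrow> l \<in> K \<Longrightarrow> k \<noteq> l \<Longrightarrow> x \<in> X \<Longrightarrow> y \<in> X \<Longrightarrow> \<delta> \<le> dist (G k x) (G l y)"
    by blast
  have "J \<noteq> {}" using J X by auto
  then have cardJ: "0 < card J" using J by (simp add: card_gt_0_iff)
  \<comment> \<open>Pulling back by \<open>h\<close> costs the factor \<open>b powr s\<close>, and
    splitting each covering set along the \<open>P j\<close> costs \<open>card J\<close>.\<close>
  define \<kappa> where "\<kappa> = b powr s * \<delta> powr s / card J"
  have "0 < \<kappa>" using \<open>0 < b\<close> \<open>0 < \<delta>\<close> cardJ by (simp add: \<kappa>_def)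
  show ?thesis
  proof (rule hausdorff_dim_gt_oneI[OF s(1) \<open>0 < \<kappa>\<close>])
    fix U :: "nat \<Rightarrow> complex set"
    assume cov: "E \<subseteq> (\<Union>i. U i)" and bdd: "\<And>i. bounded (U i)"
    let ?S = "\<Sum>i. ennreal (diameter (U i) powr s)"
    show "ennreal \<kappa> \<le> ?S"
    proof (rule ennreal_le_epsilon)
      fix \<epsilon> :: real assume "0 < \<epsilon>"
      have "\<exists>e. 0 < e \<and> (diameter (U i) + 2 * e) powr s \<le> diameter (U i) powr s + \<epsilon> / 2 ^ Suc i" for i
        using ex_enlargement[of "diameter (U i)" s "\<epsilon> / 2 ^ Suc i"] diameter_ge_0[OF bdd] s \<open>0 < \<epsilon>\<close>
        by (metis divide_pos_pos less_trans zero_less_numeral zero_less_one zero_less_power)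
      then obtain e where e: "\<And>i. 0 < e i"
        "\<And>i. (diameter (U i) + 2 * e i) powr s \<le> diameter (U i) powr s + \<epsilon> / 2 ^ Suc i"
        by metis
      define W where "W i = (\<Union>x\<in>U i. ball x (e i))" for i
      have W_dist: "dist x y \<le> diameter (U i) + 2 * e i" if "x \<in> W i" "y \<in> W i" for i x y
      proof -
        obtain x' y' where xy: "x' \<in> U i" "y' \<in> U i" "dist x' x < e i" "dist y' y < e i"
          using \<open>x \<in> W i\<close> \<open>y \<in> W i\<close> by (auto simp: W_def)
        have "dist x' y' \<le> diameter (U i)" using xy bdd by (intro diameter_bounded_bound) auto
        then show ?thesis using xy dist_triangle[of x y x'] dist_triangle[of x' y y'] 
          by (simp add: dist_commute)
      qed
      have "h ` X \<subseteq> (\<Union>i. W i)"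
      proof
        fix z assume "z \<in> h ` X"
        then obtain i where "z \<in> U i" using h cov by blast
        then have "z \<in> W i" unfolding W_def using centre_in_ball e(1) by blast
          then show "z \<in> (\<Union>i. W i)" by blast
      qed
      moreover have "compact (h ` X)" using h X by (intro compact_continuous_image) auto
      moreover have "open (W i)" for i by (auto simp: W_def)
      ultimately obtain I where I: "finite I" "h ` X \<subseteq> (\<Union>i\<in>I. W i)"
        by (elim compactE_image[of "h ` X" UNIV W]) auto
      define V where "V = (\<lambda>(i,j). {x \<in> X \<inter> P j. h x \<in> W i})"
      have V: "bounded (V p) \<and> diameter (V p) \<le> (diameter (U (fst p)) + 2 * e (fst p)) / b" if p_in: "p \<in> I \<times> J" for p
      proof -
        obtain i j where p: "p = (i,j)" "j \<in> J" using p_in by blast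
        have "dist x y \<le> (diameter (U i) + 2 * e i) / b" if "x \<in> V p" "y \<in> V p" for x y
        proof -
          have "b * dist x y \<le> dist (h x) (h y)"
            using h_expand that p by (auto simp: V_def)
          also have "\<dots> \<le> diameter (U i) + 2 * e i" using W_dist that p by (auto simp: V_def)
          finally show ?thesis using \<open>0 < b\<close> by (simp add: field_simps)
        qed
        moreover have "0 \<le> (diameter (U i) + 2 * e i) / b"
          using diameter_ge_0[OF bdd[of i]] e(1)[of i] \<open>0 < b\<close> by simp
        ultimately show ?thesis using diameter_le_of_dist[of _ "V p"] p by (metis fst_conv)
      qed
      have "\<delta> powr s \<le> (\<Sum>p\<in>I \<times> J. diameter (V p) powr s)"
      proof (rule finite_cover_sum_ge[OF K X(2) maps c_pos expand \<open>0 < \<delta>\<close> gap _ s(2)])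
        show "X \<subseteq> (\<Union>p\<in>I \<times> J. V p)"
        proof
          fix x assume "x \<in> X"
          then obtain i j where "i \<in> I" "h x \<in> W i" "j \<in> J" "x \<in> P j"
            using I(2) J(2) by blast
          then show "x \<in> (\<Union>p\<in>I \<times> J. V p)"
            using \<open>x \<in> X\<close> by (intro UN_I[of "(i,j)"]) (auto simp: V_def)
        qed
      qed (use I J V s in auto)
      also have "\<dots> \<le> (\<Sum>p\<in>I \<times> J. ((diameter (U (fst p)) + 2 * e (fst p)) / b) powr s)"
        using V s by (intro sum_mono powr_mono2) (auto simp: diameter_ge_0)
      also have "\<dots> = card J * (\<Sum>i\<in>I. ((diameter (U i) + 2 * e i) / b) powr s)"
        by (simp add: sum.cartesian_product' sum_distrib_left)
      also have "\<dots> = card J * (\<Sum>i\<in>I. (diameter (U i) + 2 * e i) powr s) / b powr s"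
        using diameter_ge_0[OF bdd] e(1) \<open>0 < b\<close>
        by (simp add: powr_divide add_nonneg_nonneg less_imp_le flip: sum_divide_distrib)
      finally have "\<kappa> \<le> (\<Sum>i\<in>I. (diameter (U i) + 2 * e i) powr s)"
        using \<open>0 < b\<close> cardJ by (simp add: \<kappa>_def field_simps)
      also have "\<dots> \<le> (\<Sum>i\<in>I. diameter (U i) powr s + \<epsilon> / 2 ^ Suc i)"
        by (intro sum_mono e)
      also have "\<dots> = (\<Sum>i\<in>I. diameter (U i) powr s) + (\<Sum>i\<in>I. \<epsilon> * (1/2) ^ Suc i)"
        by (simp add: sum.distrib power_divide)
      also have "(\<Sum>i\<in>I. \<epsilon> * (1/2) ^ Suc i) \<le> \<epsilon>"
      proof -
        have "(\<lambda>i. \<epsilon> * (1/2) ^ Suc i) sums (\<epsilon> * 1)" by (intro sums_mult power_half_series)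
        then have sm: "summable (\<lambda>i. \<epsilon> * (1/2) ^ Suc i)" "(\<Sum>i. \<epsilon> * (1/2) ^ Suc i) = \<epsilon>"
          by (auto simp only: sums_iff mult_1_right)
        show ?thesis
          using sum_le_suminf[OF sm(1) I(1)] \<open>0 < \<epsilon>\<close> unfolding sm(2) by simp
      qed
      finally have "ennreal \<kappa> \<le> ennreal ((\<Sum>i\<in>I. diameter (U i) powr s) + \<epsilon>)"
        by (intro ennreal_leI) simp
      also have "\<dots> = (\<Sum>i\<in>I. ennreal (diameter (U i) powr s)) + ennreal \<epsilon>"
        using \<open>0 < \<epsilon>\<close> by (simp add: sum_nonneg)
      also have "\<dots> \<le> ?S + ennreal \<epsilon>"
        using I(1) by (intro add_right_mono sum_le_suminf) auto
      finally show "ennreal \<kappa> \<le> ?S + ennreal \<epsilon>" .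
    qed
  qed
qed

section \<open>Univalent functions\<close>

text \<open>By Bloch's theorem the image of \<open>l\<close> contains a disc of radius
  \<open>r * norm (deriv l a) / 12\<close>. A radius above \<open>pi\<close> would fit two points
  that differ by \<open>2 * pi * \<i>\<close>, against injectivity of
  \<open>exp \<circ> l\<close>.\<close>

lemma deriv_log_of_univalent_le:
  assumes hol: "l holomorphic_on ball a r" and "0 < r"
    and inj: "inj_on (\<lambda>z. exp (l z)) (ball a r)"
  shows "r * norm (deriv l a) \<le> 12 * pi"
proof (rule ccontr)
  assume "\<not> ?thesis"
  then have big: "pi < r * norm (deriv l a) / 12" by simp
  obtain b where b: "ball b (r * norm (deriv l a) / 12) \<subseteq> l ` ball a r"
    using Bloch[OF hol \<open>0 < r\<close> order_refl] by blast
  have "b + \<i> * pi \<in> ball b (r * norm (deriv l a) / 12)" "b - \<i> * pi \<in> ball b (r * norm (deriv l a) / 12)"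
    using big by (auto simp: dist_norm norm_mult)
  then have "b + \<i> * pi \<in> l ` ball a r" "b - \<i> * pi \<in> l ` ball a r"
    using b by blast+
  then obtain x y where xy: "x \<in> ball a r" "y \<in> ball a r" "l x = b + \<i> * pi" "l y = b - \<i> * pi"
    by force
  then have "exp (l x) = exp (l y)" by (simp add: exp_add exp_diff)
  then have "x = y" using inj_onD[OF inj] xy(1,2) by metis
  then have "Im (b + \<i> * pi) = Im (b - \<i> * pi)" using xy(3,4) by metis
  then show False by simp
qed

text \<open>Makes the bound for logarithms of univalent functions available for a univalent
  \<open>h\<close>, by way of a logarithm of \<open>w - h\<close>.\<close>

lemma omitted_value_log:
  assumes hol: "h holomorphic_on ball a r" and inj: "inj_on h (ball a r)" and w: "w \<notin> h ` ball a r"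
  obtains l where "l holomorphic_on ball a r" "\<And>z. z \<in> ball a r \<Longrightarrow> w - h z = exp (l z)"
    "inj_on (\<lambda>z. exp (l z)) (ball a r)"
    "\<And>z. z \<in> ball a r \<Longrightarrow> norm (deriv h z) = norm (deriv l z) * norm (w - h z)"
proof -
  have "simply_connected (ball a r)" by (simp add: convex_imp_simply_connected)
  moreover have "(\<lambda>z. w - h z) holomorphic_on ball a r" by (intro holomorphic_intros hol)
  moreover have "\<And>z. z \<in> ball a r \<Longrightarrow> w - h z \<noteq> 0" using w by force
  ultimately obtain l where l: "l holomorphic_on ball a r" "\<And>z. z \<in> ball a r \<Longrightarrow> w - h z = exp (l z)"
    using simply_connected_eq_holomorphic_log[OF open_ball] by blast
  show thesis
  proof (rule that[OF l])
    show "inj_on (\<lambda>z. exp (l z)) (ball a r)"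
      using inj by (auto simp: inj_on_def simp flip: l(2))
    fix z assume z: "z \<in> ball a r"
    have "((\<lambda>z. w - h z) has_field_derivative - deriv h z) (at z)"
      using holomorphic_derivI[OF hol open_ball z] by (auto intro!: derivative_eq_intros)
    moreover have "((\<lambda>z. exp (l z)) has_field_derivative exp (l z) * deriv l z) (at z)"
      using holomorphic_derivI[OF l(1) open_ball z] by (auto intro!: derivative_eq_intros)
    then have "((\<lambda>z. w - h z) has_field_derivative exp (l z) * deriv l z) (at z)"
      by (rule has_field_derivative_transform_within_open[OF _ open_ball z]) (use l in auto)
    ultimately have "- deriv h z = exp (l z) * deriv l z" by (rule DERIV_unique)
    then have "deriv h z = - (exp (l z) * deriv l z)" by (metis minus_minus)
    then show "norm (deriv h z) = norm (deriv l z) * norm (w - h z)"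
      using l(2)[OF z] by (simp add: norm_mult)
  qed
qed

text \<open>A Koebe-type covering estimate with constant \<open>12 * pi\<close> in place of 4,
  obtained by applying Bloch's theorem to a logarithm of \<open>w - h\<close>.\<close>

lemma univalent_omitted_value_dist:
  assumes "h holomorphic_on ball a r" "0 < r" "inj_on h (ball a r)" "w \<notin> h ` ball a r"
  shows "r * norm (deriv h a) \<le> 12 * pi * norm (w - h a)"
proof -
  obtain l where l: "l holomorphic_on ball a r" "inj_on (\<lambda>z. exp (l z)) (ball a r)"
    "\<And>z. z \<in> ball a r \<Longrightarrow> norm (deriv h z) = norm (deriv l z) * norm (w - h z)"
    using omitted_value_log[OF assms(1,3,4)] by metis
  have "r * norm (deriv h a) = r * norm (deriv l a) * norm (w - h a)"
    using l(3)[of a] \<open>0 < r\<close> by simp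
  also have "\<dots> \<le> 12 * pi * norm (w - h a)"
    using deriv_log_of_univalent_le[OF l(1) \<open>0 < r\<close> l(2)] by (intro mult_right_mono) auto
  finally show ?thesis .
qed

text \<open>If the image contained the closed disc of radius
  \<open>2 * r * norm (deriv h a)\<close>, Cauchy's estimate for the inverse \<open>g\<close> would
  give \<open>norm (deriv g (h a)) * norm (deriv h a) \<le> 1/2\<close>, whereas this product is
  1.\<close>

lemma univalent_ex_omitted_value:
  assumes hol: "h holomorphic_on ball a r" and "0 < r" and inj: "inj_on h (ball a r)"
  obtains w where "w \<notin> h ` ball a r" "norm (w - h a) \<le> 2 * r * norm (deriv h a)"
proof -
  have d0: "deriv h a \<noteq> 0"
    using holomorphic_injective_imp_regular[OF hol open_ball inj] \<open>0 < r\<close> by simp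
  have "\<not> cball (h a) (2 * r * norm (deriv h a)) \<subseteq> h ` ball a r"
  proof
    assume sub: "cball (h a) (2 * r * norm (deriv h a)) \<subseteq> h ` ball a r"
    obtain g where g: "g holomorphic_on h ` ball a r"
      "\<And>z. z \<in> ball a r \<Longrightarrow> deriv h z * deriv g (h z) = 1" "\<And>z. z \<in> ball a r \<Longrightarrow> g (h z) = z"
      using holomorphic_has_inverse[OF hol open_ball inj] by metis
    let ?\<rho> = "2 * r * norm (deriv h a)"
    have \<rho>: "0 < ?\<rho>" using d0 \<open>0 < r\<close> by simp
    have hol': "(\<lambda>z. g z - a) holomorphic_on cball (h a) ?\<rho>"
      by (intro holomorphic_intros holomorphic_on_subset[OF g(1)] sub)
    have "norm ((deriv ^^ 1) (\<lambda>z. g z - a) (h a)) \<le> fact 1 * r / ?\<rho> ^ 1"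
    proof (rule Cauchy_inequality)
      show "continuous_on (cball (h a) ?\<rho>) (\<lambda>z. g z - a)"
        using hol' by (rule holomorphic_on_imp_continuous_on)
      show "(\<lambda>z. g z - a) holomorphic_on ball (h a) ?\<rho>"
        using hol' ball_subset_cball by (rule holomorphic_on_subset)
      fix x assume "norm (h a - x) = ?\<rho>"
      then have "x \<in> h ` ball a r" using sub by (auto simp: dist_norm)
      then show "norm (g x - a) \<le> r" using g(3) by (force simp: dist_norm norm_minus_commute)
    qed (use \<rho> in auto)
    moreover have "deriv (\<lambda>z. g z - a) (h a) = deriv g (h a)"
      using holomorphic_on_imp_differentiable_at[OF g(1) open_mapping_thm3[OF hol open_ball inj]] \<open>0 < r\<close>
      by (subst deriv_diff) auto
    ultimately have "norm (deriv g (h a)) * norm (deriv h a) \<le> 1/2"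
      using d0 \<open>0 < r\<close> by (simp add: field_simps)
    moreover have "norm (deriv g (h a)) * norm (deriv h a) = 1"
      using g(2)[of a] \<open>0 < r\<close> by (metis centre_in_ball mult.commute norm_mult norm_one)
    ultimately show False by simp
  qed
  then show thesis using that by (force simp: dist_norm norm_minus_commute)
qed

text \<open>The product of the bound \<open>24 * pi / r\<close> for a logarithmic derivative, the
  variation \<open>exp (12 * pi)\<close> of \<open>w - h\<close> over the half-size disc, and the
  factor \<open>2 * r\<close> from the distance to the omitted value.\<close>

definition koebe_const :: real where
  "koebe_const = 48 * pi * exp (12 * pi)"

lemma koebe_const_pos: "0 < koebe_const"
  by (simp add: koebe_const_def)

text \<open>A weak form of the Koebe distortion theorem: the logarithm of \<open>w - h\<close>, with \<open>w\<close> a nearby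
  omitted value, has controlled derivative by Bloch's theorem.\<close>

lemma univalent_deriv_le:
  assumes hol: "h holomorphic_on ball a r" and "0 < r" and inj: "inj_on h (ball a r)"
    and z: "z \<in> ball a (r / 2)"
  shows "norm (deriv h z) \<le> koebe_const * norm (deriv h a)"
proof -
  obtain w where w: "w \<notin> h ` ball a r" "norm (w - h a) \<le> 2 * r * norm (deriv h a)"
    using univalent_ex_omitted_value[OF assms(1-3)] by blast
  obtain l where l: "l holomorphic_on ball a r" "\<And>z. z \<in> ball a r \<Longrightarrow> w - h z = exp (l z)"
    "inj_on (\<lambda>z. exp (l z)) (ball a r)"
    "\<And>z. z \<in> ball a r \<Longrightarrow> norm (deriv h z) = norm (deriv l z) * norm (w - h z)"
    using omitted_value_log[OF hol inj w(1)] by metis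
  have sub: "ball x (r/2) \<subseteq> ball a r" if "x \<in> ball a (r/2)" for x
  proof
    fix y assume "y \<in> ball x (r/2)"
    then show "y \<in> ball a r" using that dist_triangle[of a y x] by simp
  qed
  \<comment> \<open>Only the disc of radius \<open>r / 2\<close> about \<open>x\<close> is
    available, hence 24 rather than 12.\<close>
  have dl: "norm (deriv l x) \<le> 24 * pi / r" if "x \<in> ball a (r/2)" for x
  proof -
    have "r / 2 * norm (deriv l x) \<le> 12 * pi"
      using sub[OF that] l \<open>0 < r\<close>
      by (intro deriv_log_of_univalent_le holomorphic_on_subset[OF l(1)] inj_on_subset[OF l(3)]) auto
    then show ?thesis using \<open>0 < r\<close> by (simp add: field_simps)
  qed
  have half: "ball a (r/2) \<subseteq> ball a r" using \<open>0 < r\<close> by (intro subset_ball) simp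
  have "norm (l z - l a) \<le> 24 * pi / r * norm (z - a)"
  proof (rule field_differentiable_bound[where S="ball a (r/2)"])
    fix x assume "x \<in> ball a (r/2)"
    then show "(l has_field_derivative deriv l x) (at x within ball a (r/2))"
      using holomorphic_derivI[OF l(1) open_ball] half DERIV_subset by blast
  qed (use dl z \<open>0 < r\<close> in auto)
  also have "\<dots> \<le> 24 * pi / r * (r / 2)"
    using z \<open>0 < r\<close> by (intro mult_left_mono) (auto simp: dist_norm norm_minus_commute)
  also have "\<dots> = 12 * pi" using \<open>0 < r\<close> by simp
  finally have "Re (l z) - Re (l a) \<le> 12 * pi"
    by (metis complex_Re_le_cmod minus_complex.simps(1) order_trans)
  then have "norm (w - h z) \<le> exp (12 * pi) * norm (w - h a)"
    using z \<open>0 < r\<close> half by (simp add: l(2) subset_iff flip: exp_add)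
  also have "\<dots> \<le> exp (12 * pi) * (2 * r * norm (deriv h a))"
    using w(2) by (intro mult_left_mono) auto
  finally have "norm (deriv l z) * norm (w - h z) \<le> (24 * pi / r) * (exp (12 * pi) * (2 * r * norm (deriv h a)))"
    using dl[OF z] \<open>0 < r\<close> by (intro mult_mono) auto
  then show ?thesis using l(4)[of z] z half \<open>0 < r\<close> by (auto simp: koebe_const_def field_simps)
qed

text \<open>The upper bound with the roles of the points exchanged: \<open>a\<close> lies in the
  half-size disc of \<open>ball z (3 * r / 4)\<close>, since
  \<open>r / 4 < 3 * r / 8\<close>.\<close>

lemma univalent_deriv_ge:
  assumes hol: "h holomorphic_on ball a r" and "0 < r" and inj: "inj_on h (ball a r)"
    and z: "z \<in> ball a (r / 4)"
  shows "norm (deriv h a) \<le> koebe_const * norm (deriv h z)"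
proof -
  have "ball z (3 * r / 4) \<subseteq> ball a r"
  proof
    fix y assume "y \<in> ball z (3 * r / 4)"
    then show "y \<in> ball a r" using z dist_triangle[of a y z] by simp
  qed
  then show ?thesis
    using z \<open>0 < r\<close>
    by (intro univalent_deriv_le[where r="3 * r / 4"] holomorphic_on_subset[OF hol] inj_on_subset[OF inj])
       (auto simp: dist_commute)
qed

text \<open>The point \<open>y\<close> lies outside the open disc \<open>ball x (dist x y)\<close>,
  so by injectivity \<open>h y\<close> is a value omitted on that disc.\<close>

lemma univalent_dist_ge:
  assumes "h holomorphic_on S" "inj_on h S" "ball x (dist x y) \<subseteq> S" "x \<in> S" "y \<in> S"
  shows "norm (deriv h x) * dist x y \<le> 12 * pi * dist (h x) (h y)"
proof (cases "x = y")
  case False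
  have "h y \<notin> h ` ball x (dist x y)"
    using inj_on_image_mem_iff[OF assms(2,5,3)] by simp
  then have "dist x y * norm (deriv h x) \<le> 12 * pi * norm (h y - h x)"
    using False assms
    by (intro univalent_omitted_value_dist) (auto intro: holomorphic_on_subset inj_on_subset)
  then show ?thesis by (simp add: dist_norm norm_minus_commute mult.commute)
qed auto

section \<open>Logarithmic coordinates in a tract\<close>

text \<open>\<open>F\<close> is a logarithm of \<open>f\<close> on the simply connected
  \<open>D\<close>, and \<open>g\<close> is a lift of \<open>exp\<close> through the covering
  \<open>f\<close>. Uniqueness of lifts through \<open>exp\<close> and through \<open>f\<close>
  shows that \<open>F\<close> and \<open>g\<close> are mutually inverse.\<close>

lemma logarithmic_tract_parametrization:
  assumes "logarithmic_tract f D R"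
  obtains \<phi> where "\<phi> holomorphic_on {\<zeta>. ln R < Re \<zeta>}" "inj_on \<phi> {\<zeta>. ln R < Re \<zeta>}"
    "\<phi> ` {\<zeta>. ln R < Re \<zeta>} = D" "\<And>\<zeta>. ln R < Re \<zeta> \<Longrightarrow> f (\<phi> \<zeta>) = exp \<zeta>"
proof -
  define H where "H = {\<zeta>. ln R < Re \<zeta>}"
  have D: "open D" "D \<noteq> {}" "connected D" "f holomorphic_on D" "0 < R" "\<And>z. z \<in> D \<Longrightarrow> R < norm (f z)"
    "simply_connected D" and cov: "covering_space D f {w. R < norm w}"
    using assms by (auto simp: logarithmic_tract_def direct_tract_def)
  have H: "open H" "convex H" by (auto simp: H_def open_halfspace_Re_gt convex_halfspace_Re_gt)
  have "f z \<noteq> 0" if "z \<in> D" for z using D(5) D(6)[OF that] by auto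
  then obtain F where F: "F holomorphic_on D" "\<And>z. z \<in> D \<Longrightarrow> f z = exp (F z)"
    using D(4,7) simply_connected_eq_holomorphic_log[OF D(1)] by metis
  have FH: "F z \<in> H" if "z \<in> D" for z
  proof -
    have "R < exp (Re (F z))" using D(6)[OF that] F(2)[OF that] by simp
    then show ?thesis using D(5) unfolding H_def mem_Collect_eq
      by (metis exp_gt_zero ln_exp ln_less_cancel_iff)
  qed
  obtain z0 where z0: "z0 \<in> D" using D(2) by blast
  obtain g where g: "continuous_on H g" "g \<in> H \<rightarrow> D" "g (F z0) = z0" "\<And>y. y \<in> H \<Longrightarrow> f (g y) = exp y"
  proof (rule covering_space_lift_strong[OF cov z0 FH[OF z0]])
    show "simply_connected H" using H by (simp add: convex_imp_simply_connected)
    show "locally path_connected H" using H by (simp add: open_imp_locally_path_connected)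
    show "exp \<in> H \<rightarrow> {w. R < norm w}"
      using D(5) by (auto simp: H_def) (metis exp_less_cancel_iff exp_ln)
    show "exp (F z0) = f z0" using F(2) z0 by simp
  qed (auto intro: continuous_intros)
  have Fg: "F (g y) = y" if "y \<in> H" for y
  proof (rule covering_space_lift_unique[OF covering_space_exp_punctured_plane, of "\<lambda>y. F (g y)" "F z0" "\<lambda>y. y" H exp])
    show "continuous_on H (\<lambda>y. F (g y))"
      using g by (intro continuous_on_compose2[OF holomorphic_on_imp_continuous_on[OF F(1)]]) auto
    show "exp x = exp (F (g x))" if "x \<in> H" for x
      using g(2,4) F(2) that by (metis PiE)
  qed (use g that H FH[OF z0] in \<open>auto intro: continuous_intros convex_connected\<close>)
  have gF: "g (F z) = z" if "z \<in> D" for z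
  proof (rule covering_space_lift_unique[OF cov, of "\<lambda>z. g (F z)" z0 "\<lambda>z. z" D f])
    show "continuous_on D (\<lambda>z. g (F z))"
      using FH by (intro continuous_on_compose2[OF g(1)] holomorphic_on_imp_continuous_on[OF F(1)]) auto
    show "continuous_on D f" using D(4) by (rule holomorphic_on_imp_continuous_on)
    show "(\<lambda>z. g (F z)) \<in> D \<rightarrow> D" using FH g(2) by auto
    show "f x = f (g (F x))" if "x \<in> D" for x
      using g(4)[OF FH[OF that]] F(2)[OF that] by simp
  qed (use g that D z0 in \<open>auto intro: continuous_intros\<close>)
  have FD: "F ` D = H"
  proof
    show "H \<subseteq> F ` D" using Fg g(2) by (metis PiE image_eqI subsetI)
  qed (use FH in auto)
  have "inj_on F D" using gF by (metis inj_onI)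
  \<comment> \<open>Lifting makes \<open>g\<close> continuous only; the holomorphic inverse of
    \<open>F\<close> coincides with it.\<close>
  then obtain g' where g': "g' holomorphic_on H" "\<And>z. z \<in> D \<Longrightarrow> g' (F z) = z"
    using holomorphic_has_inverse[OF F(1) D(1)] FD by metis
  have eq: "g' y = g y" if "y \<in> H" for y
    using g'(2)[of "g y"] g(2) Fg that by auto
  show thesis
  proof (rule that[of g'])
    show "inj_on g' {\<zeta>. ln R < Re \<zeta>}"
      using Fg unfolding H_def[symmetric] by (metis eq inj_onI)
    show "g' ` {\<zeta>. ln R < Re \<zeta>} = D"
      unfolding H_def[symmetric] FD[symmetric] image_image using g'(2) by simp
    show "f (g' \<zeta>) = exp \<zeta>" if "ln R < Re \<zeta>" for \<zeta>
      using eq[of \<zeta>] g(4)[of \<zeta>] that by (simp add: H_def)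
  qed (use g' H_def in auto)
qed

text \<open>Compactness of the bounded part of \<open>closure D\<close>. By contraposition, points
  with large \<open>norm (f z)\<close> are large themselves.\<close>

lemma direct_tract_bounded_on_cball:
  assumes "direct_tract f D R"
  obtains C where "0 < C" "\<And>z. z \<in> closure D \<Longrightarrow> norm z \<le> B \<Longrightarrow> norm (f z) \<le> C"
proof -
  have "compact (closure D \<inter> cball 0 B)" by (intro closed_Int_compact) auto
  moreover have "continuous_on (closure D \<inter> cball 0 B) f"
    using assms by (auto simp: direct_tract_def intro: continuous_on_subset)
  ultimately have "bounded (f ` (closure D \<inter> cball 0 B))"
    by (intro compact_imp_bounded compact_continuous_image)
  then obtain C where "0 < C" "\<forall>w\<in>f ` (closure D \<inter> cball 0 B). norm w \<le> C"
    by (meson bounded_pos)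
  then show thesis using that by auto
qed

text \<open>\<open>\<Phi>\<close> is a logarithm of the inverse of \<open>log f\<close>: \<open>f\<close> acts in the logarithmic coordinate \<open>u\<close>
  of \<open>z = exp u\<close> through the inverse branches \<open>u \<mapsto> \<Phi> (u + 2 \<pi> i k)\<close>.\<close>

locale log_coordinates =
  fixes f :: "complex \<Rightarrow> complex" and D :: "complex set" and R x0 :: real and \<Phi> :: "complex \<Rightarrow> complex"
  assumes tract: "direct_tract f D R"
    and x0: "ln R \<le> x0"
    and hol: "\<Phi> holomorphic_on {\<zeta>. x0 < Re \<zeta>}"
    and inj_exp: "inj_on (\<lambda>\<zeta>. exp (\<Phi> \<zeta>)) {\<zeta>. x0 < Re \<zeta>}"
    and exp_in: "x0 < Re \<zeta> \<Longrightarrow> exp (\<Phi> \<zeta>) \<in> D"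
    and f_exp: "x0 < Re \<zeta> \<Longrightarrow> f (exp (\<Phi> \<zeta>)) = exp \<zeta>"
    and onto: "z \<in> D \<Longrightarrow> exp x0 < norm (f z) \<Longrightarrow> \<exists>\<zeta>. x0 < Re \<zeta> \<and> exp (\<Phi> \<zeta>) = z"

lemma logarithmic_tract_log_coordinates:
  assumes "logarithmic_tract f D R"
  obtains x0 \<Phi> where "log_coordinates f D R x0 \<Phi>"
proof -
  obtain \<phi> where \<phi>: "\<phi> holomorphic_on {\<zeta>. ln R < Re \<zeta>}" "inj_on \<phi> {\<zeta>. ln R < Re \<zeta>}"
    "\<phi> ` {\<zeta>. ln R < Re \<zeta>} = D" "\<And>\<zeta>. ln R < Re \<zeta> \<Longrightarrow> f (\<phi> \<zeta>) = exp \<zeta>"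
    using logarithmic_tract_parametrization[OF assms] by blast
  have dt: "direct_tract f D R" using assms by (simp add: logarithmic_tract_def)
  then have R: "0 < R" by (simp add: direct_tract_def)
  \<comment> \<open>The ball of radius 0 is the origin: \<open>C\<close> bounds
    \<open>norm (f 0)\<close> in case 0 lies in \<open>closure D\<close>. To the right of
    \<open>ln C\<close> the map \<open>\<phi>\<close> therefore omits 0 and has a logarithm.\<close>
  obtain C where C: "0 < C" "\<And>z. z \<in> closure D \<Longrightarrow> norm z \<le> 0 \<Longrightarrow> norm (f z) \<le> C"
    using direct_tract_bounded_on_cball[OF dt] by blast
  define x0 where "x0 = max (ln R) (ln C)"
  have sub: "{\<zeta>. x0 < Re \<zeta>} \<subseteq> {\<zeta>. ln R < Re \<zeta>}" by (auto simp: x0_def)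
  have \<phi>D: "\<phi> \<zeta> \<in> D" if "x0 < Re \<zeta>" for \<zeta> using \<phi>(3) sub that by blast
  have nz: "\<phi> \<zeta> \<noteq> 0" if "x0 < Re \<zeta>" for \<zeta>
  proof
    assume 0: "\<phi> \<zeta> = 0"
    have "norm (f (\<phi> \<zeta>)) \<le> C" using C(2)[of "\<phi> \<zeta>"] \<phi>D[OF that] closure_subset 0 by auto
    then have "exp (Re \<zeta>) \<le> C" using \<phi>(4)[of \<zeta>] sub that by auto
    then have "Re \<zeta> \<le> ln C" using C(1) by (simp add: ln_ge_iff)
    then show False using that by (simp add: x0_def)
  qed
  have "simply_connected {\<zeta>. x0 < Re \<zeta>}"
    by (simp add: convex_imp_simply_connected convex_halfspace_Re_gt)
  then obtain \<Phi> where \<Phi>: "\<Phi> holomorphic_on {\<zeta>. x0 < Re \<zeta>}" "\<And>\<zeta>. x0 < Re \<zeta> \<Longrightarrow> \<phi> \<zeta> = exp (\<Phi> \<zeta>)"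
    using simply_connected_eq_holomorphic_log[OF open_halfspace_Re_gt] holomorphic_on_subset[OF \<phi>(1) sub] nz
    by (metis (no_types, lifting) mem_Collect_eq)
  show thesis
  proof (rule that, unfold_locales)
    show "inj_on (\<lambda>\<zeta>. exp (\<Phi> \<zeta>)) {\<zeta>. x0 < Re \<zeta>}"
      using inj_on_subset[OF \<phi>(2) sub] \<Phi>(2) by (simp add: inj_on_def)
    show "\<exists>\<zeta>. x0 < Re \<zeta> \<and> exp (\<Phi> \<zeta>) = z" if "z \<in> D" "exp x0 < norm (f z)" for z
    proof -
      obtain \<zeta> where \<zeta>: "ln R < Re \<zeta>" "\<phi> \<zeta> = z" using \<phi>(3) \<open>z \<in> D\<close> by blast
      then have "exp x0 < exp (Re \<zeta>)" using \<phi>(4)[of \<zeta>] that by simp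
      then show ?thesis using \<zeta> \<Phi>(2) by auto
    qed
    show "f (exp (\<Phi> \<zeta>)) = exp \<zeta>" if "x0 < Re \<zeta>" for \<zeta>
      using \<phi>(4)[of \<zeta>] \<Phi>(2)[OF that] that by (simp add: x0_def)
    show "exp (\<Phi> \<zeta>) \<in> D" if "x0 < Re \<zeta>" for \<zeta>
      using \<phi>D[OF that] \<Phi>(2)[OF that] by simp
  qed (use dt \<Phi>(1) in \<open>auto simp: x0_def\<close>)
qed

section \<open>Derivative estimates and boundary behaviour of \<open>\<Phi>\<close>\<close>

context log_coordinates
begin

lemma R_pos: "0 < R"
  using tract by (simp add: direct_tract_def)

lemma cont: "continuous_on {\<zeta>. x0 < Re \<zeta>} \<Phi>"
  using hol by (rule holomorphic_on_imp_continuous_on)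

lemma inj: "inj_on \<Phi> {\<zeta>. x0 < Re \<zeta>}"
  using inj_exp by (auto simp: inj_on_def)

lemma ball_subset: "r \<le> Re a - x0 \<Longrightarrow> ball a r \<subseteq> {\<zeta>. x0 < Re \<zeta>}"
proof
  fix z assume "r \<le> Re a - x0" "z \<in> ball a r"
  then show "z \<in> {\<zeta>. x0 < Re \<zeta>}"
    using abs_Re_le_cmod[of "a - z"] by (simp add: dist_norm)
qed

text \<open>The disc of radius \<open>Re \<zeta> - x0\<close> about \<open>\<zeta>\<close> lies in
  the half-plane. This is the Eremenko-Lyubich expansion estimate, stated for the inverse and with a
  weaker constant.\<close>

lemma deriv_le:
  assumes "x0 < Re \<zeta>"
  shows "(Re \<zeta> - x0) * norm (deriv \<Phi> \<zeta>) \<le> 12 * pi"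
  using assms ball_subset[of "Re \<zeta> - x0" \<zeta>]
  by (intro deriv_log_of_univalent_le holomorphic_on_subset[OF hol] inj_on_subset[OF inj_exp]) auto

lemma dist_le:
  assumes "0 < d" "x0 + d \<le> Re x" "x0 + d \<le> Re y"
  shows "dist (\<Phi> x) (\<Phi> y) \<le> 12 * pi / d * dist x y"
proof -
  have "norm (\<Phi> x - \<Phi> y) \<le> 12 * pi / d * norm (x - y)"
  proof (rule field_differentiable_bound[where S="{\<zeta>. x0 + d \<le> Re \<zeta>}"])
    show "convex {\<zeta>. x0 + d \<le> Re \<zeta>}" by (rule convex_halfspace_Re_ge)
    fix z assume z: "z \<in> {\<zeta>. x0 + d \<le> Re \<zeta>}"
    then have z': "x0 < Re z" "d \<le> Re z - x0" using \<open>0 < d\<close> by auto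
    then show "(\<Phi> has_field_derivative deriv \<Phi> z) (at z within {\<zeta>. x0 + d \<le> Re \<zeta>})"
      using holomorphic_derivI[OF hol open_halfspace_Re_gt] DERIV_subset by blast
    have "d * norm (deriv \<Phi> z) \<le> (Re z - x0) * norm (deriv \<Phi> z)"
      using z' by (intro mult_right_mono) auto
    also have "\<dots> \<le> 12 * pi" using z' by (intro deriv_le)
    finally show "norm (deriv \<Phi> z) \<le> 12 * pi / d" using \<open>0 < d\<close> by (simp add: field_simps)
  qed (use assms in auto)
  then show ?thesis by (simp add: dist_norm)
qed

text \<open>If \<open>exp (\<Phi> \<zeta>)\<close> stayed bounded, so would
  \<open>norm (f (exp (\<Phi> \<zeta>))) = exp (Re \<zeta>)\<close>.\<close>

lemma Re_tendsto_right: "\<exists>x1. \<forall>\<zeta>. x1 < Re \<zeta> \<longrightarrow> B < Re (\<Phi> \<zeta>)"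
proof -
  obtain C where C: "0 < C" "\<And>z. z \<in> closure D \<Longrightarrow> norm z \<le> exp B \<Longrightarrow> norm (f z) \<le> C"
    using direct_tract_bounded_on_cball[OF tract] by blast
  have "B < Re (\<Phi> \<zeta>)" if "max x0 (ln C) < Re \<zeta>" for \<zeta>
  proof (rule ccontr)
    assume "\<not> B < Re (\<Phi> \<zeta>)"
    then have "norm (f (exp (\<Phi> \<zeta>))) \<le> C"
      using exp_in[of \<zeta>] closure_subset that by (intro C) auto
    then have "Re \<zeta> \<le> ln C" using f_exp[of \<zeta>] that C(1) by (simp add: ln_ge_iff)
    then show False using that by simp
  qed
  then show ?thesis by blast
qed

lemma in_D_if_norm_gt:
  assumes "z \<in> closure D" "exp x0 < norm (f z)"
  shows "z \<in> D"
proof (rule ccontr)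
  assume "z \<notin> D"
  then have "z \<in> frontier D" using assms tract by (simp add: frontier_def direct_tract_def interior_open)
  then have "norm (f z) = R" using tract by (auto simp: direct_tract_def)
  moreover have "R \<le> exp x0" using x0 R_pos by (metis exp_le_cancel_iff exp_ln)
  ultimately show False using assms by simp
qed

text \<open>The points of \<open>closure D\<close> of modulus at most \<open>exp B\<close> with
  \<open>norm (f z) = exp x\<close> form a compact subset of the image of
  \<open>exp \<circ> \<Phi>\<close>. The inverse is continuous there, so their preimage is bounded
  and the vertical line leaves it.\<close>

lemma Re_tendsto_up:
  assumes "x0 < x"
  shows "\<exists>Y. \<forall>y>Y. B < Re (\<Phi> (Complex x y))"
proof -
  let ?E = "\<lambda>\<zeta>. exp (\<Phi> \<zeta>)" and ?H = "{\<zeta>. x0 < Re \<zeta>}"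
  have "?E holomorphic_on ?H" by (intro holomorphic_intros hol)
  then obtain F where F: "F holomorphic_on ?E ` ?H" "\<And>\<zeta>. \<zeta> \<in> ?H \<Longrightarrow> F (?E \<zeta>) = \<zeta>"
    using holomorphic_has_inverse[OF _ open_halfspace_Re_gt inj_exp] by metis
  define S where "S = {z \<in> closure D \<inter> cball 0 (exp B). norm (f z) = exp x}"
  have "closed S"
    unfolding S_def using tract
    by (intro continuous_closed_preimage_constant continuous_on_norm) (auto simp: direct_tract_def intro: continuous_on_subset)
  moreover have "bounded S" unfolding S_def by (rule bounded_subset[of "cball 0 (exp B)"]) auto
  ultimately have "compact S" by (simp add: compact_eq_bounded_closed)
  have "S \<subseteq> ?E ` ?H"
  proof
    fix z assume "z \<in> S"
    then have "z \<in> closure D" "exp x0 < norm (f z)" using assms by (auto simp: S_def)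
    then show "z \<in> ?E ` ?H" using onto in_D_if_norm_gt by fastforce
  qed
  then have "continuous_on S F"
    using F(1) holomorphic_on_imp_continuous_on holomorphic_on_subset by blast
  then have "bounded (F ` S)" using \<open>compact S\<close> by (intro compact_imp_bounded compact_continuous_image)
  then obtain Y where Y: "\<And>z. z \<in> S \<Longrightarrow> norm (F z) \<le> Y" by (auto simp: bounded_iff)
  have "B < Re (\<Phi> (Complex x y))" if "Y < y" for y
  proof (rule ccontr)
    assume "\<not> B < Re (\<Phi> (Complex x y))"
    then have "?E (Complex x y) \<in> S"
      using exp_in[of "Complex x y"] f_exp[of "Complex x y"] closure_subset assms by (auto simp: S_def)
    then have "norm (Complex x y) \<le> Y" using Y F(2)[of "Complex x y"] assms by force
    then show False using that abs_Im_le_cmod[of "Complex x y"] by simp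
  qed
  then show ?thesis by blast
qed

text \<open>At distance at least \<open>24 * pi\<close> from the boundary, \<open>\<Phi>\<close> has
  Lipschitz constant 1/2.\<close>

lemma Re_real_le: "\<exists>t. \<forall>x. x0 + 24 * pi \<le> x \<longrightarrow> Re (\<Phi> (of_real x)) \<le> t + x / 2"
proof (intro exI allI impI)
  let ?a = "x0 + 24 * pi"
  fix x assume x: "?a \<le> x"
  have "Re (\<Phi> (of_real x)) - Re (\<Phi> (of_real ?a)) \<le> dist (\<Phi> (of_real x)) (\<Phi> (of_real ?a))"
    unfolding dist_norm using complex_Re_le_cmod[of "\<Phi> (of_real x) - \<Phi> (of_real ?a)"] by simp
  also have "\<dots> \<le> 12 * pi / (24 * pi) * dist (complex_of_real x) (of_real ?a)"
    using x by (intro dist_le) auto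
  also have "dist (complex_of_real x) (of_real ?a) = x - ?a"
    using x by (simp add: dist_norm flip: of_real_diff of_real_add)
  finally show "Re (\<Phi> (of_real x)) \<le> (Re (\<Phi> (of_real ?a)) - ?a / 2) + x / 2"
    by (simp add: field_simps)
qed

lemma ex_real_preimage: "\<exists>t1. \<forall>t\<ge>t1. \<exists>x. x0 < x \<and> t \<le> x \<and> Re (\<Phi> (of_real x)) = t"
proof -
  define a where "a = x0 + 24 * pi"
  obtain s where s: "\<And>x. a \<le> x \<Longrightarrow> Re (\<Phi> (of_real x)) \<le> s + x / 2"
    using Re_real_le a_def by blast
  \<comment> \<open>The threshold \<open>2 * s\<close> turns \<open>t \<le> s + x / 2\<close> into
    \<open>t \<le> x\<close>.\<close>
  have "\<exists>x. x0 < x \<and> t \<le> x \<and> Re (\<Phi> (of_real x)) = t" if t: "max (Re (\<Phi> (of_real a))) (2 * s) \<le> t" for t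
  proof -
    obtain x1 where x1: "\<And>\<zeta>. x1 < Re \<zeta> \<Longrightarrow> t < Re (\<Phi> \<zeta>)" using Re_tendsto_right by blast
    define X where "X = max a (x1 + 1)"
    have "continuous_on {a..X} (\<lambda>x. Re (\<Phi> (of_real x)))"
      by (intro continuous_intros continuous_on_compose2[OF cont]) (auto simp: a_def intro: less_le_trans[rotated])
    moreover have "Re (\<Phi> (of_real a)) \<le> t" using t by simp
    moreover have "t \<le> Re (\<Phi> (of_real X))" by (intro less_imp_le x1) (simp add: X_def)
    ultimately obtain x where x: "a \<le> x" "Re (\<Phi> (of_real x)) = t"
      using IVT'[of "\<lambda>x. Re (\<Phi> (of_real x))" a t X] by (auto simp: X_def)
    have "x0 < x" using x(1) pi_gt_zero unfolding a_def by linarith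
    moreover have "t \<le> x" using s[OF x(1)] x(2) t by simp
    ultimately show ?thesis using x by blast
  qed
  then show ?thesis by blast
qed

end

section \<open>Points escaping at maximal rate\<close>

context log_coordinates
begin

text \<open>The maximum over the compact set \<open>closure D \<inter> sphere 0 (exp t)\<close> is
  at least \<open>exp x\<close> for a real preimage \<open>x\<close>, hence above
  \<open>exp x0 \<ge> R\<close>. So it is attained inside \<open>D\<close>, in the image of
  \<open>exp \<circ> \<Phi>\<close>.\<close>

lemma M_D_attained:
  "\<exists>t1. \<forall>t\<ge>t1. \<exists>\<zeta>. x0 < Re \<zeta> \<and> t \<le> Re \<zeta> \<and> Re (\<Phi> \<zeta>) = t \<and> M_D f D (exp t) = exp (Re \<zeta>)"
proof -
  obtain t1 where t1: "\<And>t. t1 \<le> t \<Longrightarrow> \<exists>x. x0 < x \<and> t \<le> x \<and> Re (\<Phi> (of_real x)) = t"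
    using ex_real_preimage by blast
  have "\<exists>\<zeta>. x0 < Re \<zeta> \<and> t \<le> Re \<zeta> \<and> Re (\<Phi> \<zeta>) = t \<and> M_D f D (exp t) = exp (Re \<zeta>)" if t: "t1 \<le> t" for t
  proof -
    obtain x where x: "x0 < x" "t \<le> x" "Re (\<Phi> (of_real x)) = t" using t1[OF t] by blast
    define z where "z = exp (\<Phi> (of_real x))"
    have z: "z \<in> D" "norm z = exp t" "norm (f z) = exp x"
      using exp_in[of "of_real x"] f_exp[of "of_real x"] x by (auto simp: z_def)
    define S where "S = closure D \<inter> sphere 0 (exp t)"
    have S: "compact S" unfolding S_def by (intro closed_Int_compact) auto
    have zS: "z \<in> S" using z closure_subset by (auto simp: S_def)
    have "continuous_on S (\<lambda>z. norm (f z))"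
      unfolding S_def using tract
      by (intro continuous_on_norm) (auto simp: direct_tract_def intro: continuous_on_subset)
    then obtain w where w: "w \<in> S" "\<And>y. y \<in> S \<Longrightarrow> norm (f y) \<le> norm (f w)"
      using continuous_attains_sup[OF S] zS by blast
    have wx: "exp x \<le> norm (f w)" using w(2)[OF zS] z by simp
    then have big: "exp x0 < norm (f w)" using x(1) by (meson exp_less_cancel_iff less_le_trans)
    have wD: "w \<in> D" using in_D_if_norm_gt[OF _ big] w(1) by (auto simp: S_def)
    obtain \<zeta> where \<zeta>: "x0 < Re \<zeta>" "exp (\<Phi> \<zeta>) = w" using onto[OF wD big] by blast
    have fw: "norm (f w) = exp (Re \<zeta>)" using f_exp[OF \<zeta>(1)] \<zeta>(2) by simp
    have "exp (Re (\<Phi> \<zeta>)) = exp t" using w(1) \<zeta>(2) by (auto simp: S_def)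
    then have "Re (\<Phi> \<zeta>) = t" by simp
    moreover have "t \<le> Re \<zeta>" using wx x(2) unfolding fw by simp
    moreover have "M_D f D (exp t) = norm (f w)"
      unfolding M_D_def
    proof (rule cSup_eq_maximum)
      show "norm (f w) \<in> {norm (f z) |z. z \<in> D \<and> norm z = exp t}"
        using wD w(1) by (auto simp: S_def)
      show "y \<le> norm (f w)" if "y \<in> {norm (f z) |z. z \<in> D \<and> norm z = exp t}" for y
        using that w(2) closure_subset by (auto simp: S_def)
    qed
    ultimately show ?thesis using \<zeta>(1) fw by auto
  qed
  then show ?thesis by blast
qed

text \<open>A real \<open>Sup\<close> is an upper bound only for sets bounded above; here
  \<open>f\<close> is bounded on bounded parts of \<open>D\<close>.\<close>

lemma M_D_upper:
  assumes "z \<in> D" "norm z = r"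
  shows "norm (f z) \<le> M_D f D r"
proof -
  obtain C where C: "\<And>z. z \<in> closure D \<Longrightarrow> norm z \<le> r \<Longrightarrow> norm (f z) \<le> C"
    using direct_tract_bounded_on_cball[OF tract] by blast
  show ?thesis
    unfolding M_D_def
  proof (rule cSup_upper)
    show "bdd_above {norm (f z) |z. z \<in> D \<and> norm z = r}"
      using C closure_subset by (intro bdd_aboveI[of _ C]) auto
  qed (use assms in auto)
qed

text \<open>Maximum principle on \<open>D \<inter> ball 0 (exp t')\<close>: a frontier point lies
  either in \<open>D\<close> and on the circle, or outside \<open>D\<close>, where
  \<open>norm (f z) \<le> exp x0 \<le> M_D f D (exp t')\<close>.\<close>

lemma M_D_mono:
  "\<exists>t1. \<forall>t t'. t1 \<le> t \<longrightarrow> t \<le> t' \<longrightarrow> M_D f D (exp t) \<le> M_D f D (exp t')"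
proof -
  obtain t1 where t1: "\<And>t. t1 \<le> t \<Longrightarrow>
      \<exists>\<zeta>. x0 < Re \<zeta> \<and> t \<le> Re \<zeta> \<and> Re (\<Phi> \<zeta>) = t \<and> M_D f D (exp t) = exp (Re \<zeta>)"
    using M_D_attained by blast
  have "M_D f D (exp t) \<le> M_D f D (exp t')" if t: "t1 \<le> t" "t \<le> t'" for t t'
  proof (cases "t = t'")
    case False
    then have "t < t'" using t by simp
    obtain \<zeta> where \<zeta>: "x0 < Re \<zeta>" "Re (\<Phi> \<zeta>) = t" "M_D f D (exp t) = exp (Re \<zeta>)"
      using t1[OF t(1)] by blast
    obtain \<zeta>' where \<zeta>': "x0 < Re \<zeta>'" "M_D f D (exp t') = exp (Re \<zeta>')"
      using t1[of t'] t by auto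
    let ?S = "D \<inter> ball 0 (exp t')"
    have "norm (f (exp (\<Phi> \<zeta>))) \<le> M_D f D (exp t')"
    proof (rule maximum_modulus_frontier[of f ?S "M_D f D (exp t')" "exp (\<Phi> \<zeta>)"])
      show "f holomorphic_on interior ?S"
        using tract interior_subset[of ?S] by (auto simp: direct_tract_def intro: holomorphic_on_subset)
      show "continuous_on (closure ?S) f"
        using tract closure_mono[of ?S D] by (auto simp: direct_tract_def intro: continuous_on_subset)
      show "bounded ?S" by (rule bounded_subset[of "ball 0 (exp t')"]) auto
      show "exp (\<Phi> \<zeta>) \<in> ?S" using exp_in[OF \<zeta>(1)] \<zeta>(2) \<open>t < t'\<close> by auto
      fix z assume z: "z \<in> frontier ?S"
      then have z': "z \<in> closure D" "norm z \<le> exp t'"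
        using closure_mono[of ?S D] closure_minimal[of ?S "cball 0 (exp t')"]
        by (force simp: frontier_def)+
      show "norm (f z) \<le> M_D f D (exp t')"
      proof (cases "z \<in> D")
        case True
        have "open ?S" using tract by (auto simp: direct_tract_def)
        then have "z \<notin> ?S" using z frontier_disjoint_eq[of ?S] by blast
        then have "norm z = exp t'" using True z' by auto
        then show ?thesis using M_D_upper True by blast
      next
        case False
        then have "\<not> exp x0 < norm (f z)" using in_D_if_norm_gt z' by blast
        moreover have "exp x0 \<le> exp (Re \<zeta>')" using \<zeta>' by simp
        ultimately show ?thesis unfolding \<zeta>'(2) by linarith
      qed
    qed
    then show ?thesis using f_exp[OF \<zeta>(1)] \<zeta>(3) by simp
  qed auto
  then show ?thesis by blast
qed

lemma ex_multiple_2pi: "\<exists>n::int. \<bar>y + 2 * pi * of_int n\<bar> \<le> pi"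
proof
  let ?n = "round (- y / (2 * pi))"
  have "\<bar>of_int ?n - (- y / (2 * pi))\<bar> \<le> 1/2" by (rule of_int_round_abs_le)
  then have "2 * pi * \<bar>of_int ?n - (- y / (2 * pi))\<bar> \<le> 2 * pi * (1/2)"
    by (intro mult_left_mono) auto
  also have "2 * pi * \<bar>of_int ?n - (- y / (2 * pi))\<bar> = \<bar>2 * pi * (of_int ?n - (- y / (2 * pi)))\<bar>"
    by (simp add: abs_mult)
  also have "2 * pi * (of_int ?n - (- y / (2 * pi))) = y + 2 * pi * of_int ?n"
    by (simp add: field_simps)
  finally show "\<bar>y + 2 * pi * of_int ?n\<bar> \<le> pi" by simp
qed

text \<open>The centre \<open>c'\<close> is \<open>\<zeta> + 5\<close>, where \<open>M_D\<close> is
  attained at \<open>exp (\<Phi> \<zeta>)\<close>, so its disc lies to the right of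
  \<open>\<zeta>\<close>. There the margin \<open>120 * pi\<close> gives \<open>\<Phi>\<close> the
  Lipschitz constant 1/10, and a shift by a multiple of \<open>2 * pi * \<i>\<close> brings
  \<open>\<Phi> \<zeta>\<close> within \<open>pi\<close> of \<open>c\<close>. The image is thus
  within \<open>pi + 1 < 5\<close> of \<open>c\<close>.\<close>

lemma escaping_step:
  "\<exists>t2. \<forall>c. t2 \<le> Re c \<longrightarrow> (\<exists>c' (n::int). exp (Re c' - 5) = M_D f D (exp (Re c)) \<and> Re c + 5 \<le> Re c' \<and>
      (\<forall>u\<in>cball c' 5. x0 < Re u \<and> \<Phi> u + 2 * pi * of_int n * \<i> \<in> cball c 5))"
proof -
  obtain t1 where t1: "\<And>t. t1 \<le> t \<Longrightarrow>
      \<exists>\<zeta>. x0 < Re \<zeta> \<and> t \<le> Re \<zeta> \<and> Re (\<Phi> \<zeta>) = t \<and> M_D f D (exp t) = exp (Re \<zeta>)"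
    using M_D_attained by blast
  show ?thesis
  proof (rule exI[of _ "max t1 (x0 + 120 * pi)"], intro allI impI)
    fix c assume c: "max t1 (x0 + 120 * pi) \<le> Re c"
    then obtain \<zeta> where \<zeta>: "x0 < Re \<zeta>" "Re c \<le> Re \<zeta>" "Re (\<Phi> \<zeta>) = Re c"
      "M_D f D (exp (Re c)) = exp (Re \<zeta>)"
      using t1[of "Re c"] by auto
    obtain n :: int where n: "\<bar>Im (\<Phi> \<zeta> - c) + 2 * pi * of_int n\<bar> \<le> pi"
      using ex_multiple_2pi by blast
    have "x0 < Re u \<and> \<Phi> u + 2 * pi * of_int n * \<i> \<in> cball c 5" if u: "u \<in> cball (\<zeta> + 5) 5" for u
    proof
      have du: "dist (\<zeta> + 5) u \<le> 5" using u by simp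
      then have "\<bar>Re (\<zeta> + 5 - u)\<bar> \<le> 5" unfolding dist_norm using abs_Re_le_cmod order_trans by blast
      then have Reu: "Re \<zeta> \<le> Re u" by simp
      then show "x0 < Re u" using \<zeta> by simp
      have "dist (\<Phi> u) (\<Phi> \<zeta>) \<le> 12 * pi / (120 * pi) * dist u \<zeta>"
        using Reu \<zeta>(2) c by (intro dist_le) auto
      also have "dist u \<zeta> \<le> 10"
        using du dist_triangle[of u \<zeta> "\<zeta> + 5"] by (simp add: dist_commute) (simp add: dist_norm)
      finally have 1: "norm (\<Phi> u - \<Phi> \<zeta>) \<le> 1" by (simp add: dist_norm)
      have "\<Phi> \<zeta> + 2 * pi * of_int n * \<i> - c = Complex 0 (Im (\<Phi> \<zeta> - c) + 2 * pi * of_int n)"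
        using \<zeta>(3) by (simp add: complex_eq_iff)
      then have "norm (\<Phi> \<zeta> + 2 * pi * of_int n * \<i> - c) \<le> pi"
        using n by (simp add: cmod_def)
      then have "norm ((\<Phi> \<zeta> + 2 * pi * of_int n * \<i> - c) + (\<Phi> u - \<Phi> \<zeta>)) \<le> 5"
        using 1 pi_less_4 norm_triangle_ineq[of "\<Phi> \<zeta> + 2 * pi * of_int n * \<i> - c" "\<Phi> u - \<Phi> \<zeta>"] by linarith
      then show "\<Phi> u + 2 * pi * of_int n * \<i> \<in> cball c 5"
        by (simp add: dist_norm norm_minus_commute[of c] algebra_simps)
    qed
    then show "\<exists>c' (n::int). exp (Re c' - 5) = M_D f D (exp (Re c)) \<and> Re c + 5 \<le> Re c' \<and>
      (\<forall>u\<in>cball c' 5. x0 < Re u \<and> \<Phi> u + 2 * pi * of_int n * \<i> \<in> cball c 5)"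
      using \<zeta> by (intro exI[of _ "\<zeta> + 5"] exI[of _ n]) auto
  qed
qed

lemma exp_plus_2pi_int: "exp (u + 2 * pi * of_int n * \<i>) = exp u"
  unfolding exp_eq by (intro exI[of _ n]) (simp add: mult_ac)

text \<open>Pulling back the discs of \<open>escaping_step\<close> gives nested compact sets. The
  orbit of a common point visits the discs one after the other, and their real parts dominate the
  logarithms of the iterates of \<open>M_D\<close>, so \<open>L = 0\<close> works.\<close>

lemma ex_escaping_point:
  "\<exists>t1. \<forall>\<rho> c. exp t1 \<le> \<rho> \<longrightarrow> t1 \<le> Re c \<longrightarrow> ln \<rho> \<le> Re c - 5 \<longrightarrow> (\<exists>u\<in>cball c 5. exp u \<in> A' f D \<rho>)"
proof -
  obtain ta where ta: "\<And>t. ta \<le> t \<Longrightarrow>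
      \<exists>\<zeta>. x0 < Re \<zeta> \<and> t \<le> Re \<zeta> \<and> Re (\<Phi> \<zeta>) = t \<and> M_D f D (exp t) = exp (Re \<zeta>)"
    using M_D_attained by blast
  obtain tb where tb: "\<And>t t'. tb \<le> t \<Longrightarrow> t \<le> t' \<Longrightarrow> M_D f D (exp t) \<le> M_D f D (exp t')"
    using M_D_mono by blast
  obtain tc where "\<forall>c. tc \<le> Re c \<longrightarrow> (\<exists>c' (n::int). exp (Re c' - 5) = M_D f D (exp (Re c)) \<and>
      Re c + 5 \<le> Re c' \<and> (\<forall>u\<in>cball c' 5. x0 < Re u \<and> \<Phi> u + 2 * pi * of_int n * \<i> \<in> cball c 5))"
    using escaping_step by blast
  then obtain nxt and sh :: "complex \<Rightarrow> int" where nxt: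
    "\<And>c. tc \<le> Re c \<Longrightarrow> exp (Re (nxt c) - 5) = M_D f D (exp (Re c))"
    "\<And>c. tc \<le> Re c \<Longrightarrow> Re c + 5 \<le> Re (nxt c)"
    "\<And>c u. tc \<le> Re c \<Longrightarrow> u \<in> cball (nxt c) 5 \<Longrightarrow> x0 < Re u \<and> \<Phi> u + 2 * pi * of_int (sh c) * \<i> \<in> cball c 5"
    by metis
  define t1 where "t1 = max ta (max tb tc)"
  have "\<exists>u\<in>cball c0 5. exp u \<in> A' f D \<rho>"
    if \<rho>: "exp t1 \<le> \<rho>" and c0: "t1 \<le> Re c0" "ln \<rho> \<le> Re c0 - 5" for \<rho> c0
  proof -
    define c where "c n = (nxt ^^ n) c0" for n
    have c_Suc: "c (Suc n) = nxt (c n)" for n by (simp add: c_def)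
    have c_ge: "t1 \<le> Re (c n)" for n
    proof (induction n)
      case (Suc n)
      then show ?case using nxt(2)[of "c n"] by (simp add: c_Suc t1_def)
    qed (use c0 in \<open>simp add: c_def\<close>)
    then have c_tc: "tc \<le> Re (c n)" for n by (simp add: t1_def)
    define \<Psi> where "\<Psi> n u = \<Phi> u + 2 * pi * of_int (sh (c n)) * \<i>" for n u
    have \<Psi>: "x0 < Re u" "\<Psi> n u \<in> cball (c n) 5" if "u \<in> cball (c (Suc n)) 5" for n u
      using nxt(3)[OF c_tc[of n], of u] that by (auto simp: \<Psi>_def c_Suc)
    have exp_\<Psi>: "exp (\<Psi> n u) = exp (\<Phi> u)" for n u
      by (simp only: \<Psi>_def exp_plus_2pi_int)
    define P where "P = rec_nat id (\<lambda>n p. p \<circ> \<Psi> n)"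
    have P_0: "P 0 = id" and P_Suc: "P (Suc n) = P n \<circ> \<Psi> n" for n by (auto simp: P_def)
    define K where "K n = P n ` cball (c n) 5" for n
    have P_cont: "continuous_on (cball (c n) 5) (P n)" for n
    proof (induction n)
      case (Suc n)
      have "continuous_on (cball (c (Suc n)) 5) (\<Psi> n)"
        unfolding \<Psi>_def using \<Psi>(1) by (intro continuous_intros continuous_on_subset[OF cont]) auto
      then show ?case
        unfolding P_Suc using \<Psi>(2) by (intro continuous_on_compose continuous_on_subset[OF Suc]) auto
    qed (simp add: P_0)
    have "K (Suc n) \<subseteq> K n" for n
      using \<Psi>(2) by (auto simp: K_def P_Suc)
    then have "K n \<subseteq> K m" if "m \<le> n" for m n
      using that by (rule lift_Suc_antimono_le)
    moreover have "compact (K n)" "K n \<noteq> {}" for n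
      unfolding K_def using P_cont by (auto intro!: compact_continuous_image)
    ultimately have "\<Inter>(range K) \<noteq> {}" by (intro compact_nest) auto
    then obtain u0 where u0: "\<And>n. u0 \<in> K n" by blast
    have fP: "(f ^^ n) (exp (P n u)) = exp u" if "u \<in> cball (c n) 5" for n u
      using that
    proof (induction n arbitrary: u)
      case (Suc n)
      have "(f ^^ Suc n) (exp (P (Suc n) u)) = f ((f ^^ n) (exp (P n (\<Psi> n u))))"
        by (simp add: P_Suc)
      also have "\<dots> = exp u" using Suc \<Psi> f_exp exp_\<Psi> by simp
      finally show ?case .
    qed (simp add: P_0)
    have inD: "(f ^^ n) (exp u0) \<in> D" for n
    proof -
      obtain u where u: "u \<in> cball (c (Suc n)) 5" "u0 = P (Suc n) u"
        using u0[of "Suc n"] by (auto simp: K_def)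
      have "(f ^^ n) (exp u0) = exp (\<Phi> u)"
        using fP[OF \<Psi>(2)[OF u(1)]] u(2) exp_\<Psi> by (simp add: P_Suc)
      then show ?thesis using exp_in \<Psi>(1)[OF u(1)] by simp
    qed
    have \<rho>_pos: "0 < \<rho>" using \<rho> by (meson exp_gt_zero less_le_trans)
    \<comment> \<open>The lower bound keeps the iterates in the range where \<open>M_D\<close> is
      monotone; the 5 is the radius of the discs.\<close>
    have M_le: "exp t1 \<le> (M_D f D ^^ n) \<rho> \<and> (M_D f D ^^ n) \<rho> \<le> exp (Re (c n) - 5)" for n
    proof (induction n)
      case 0
      have "\<rho> = exp (ln \<rho>)" using \<rho>_pos by simp
      then show ?case using \<rho> c0(2) by (simp add: c_def) (metis exp_le_cancel_iff)
    next
      case (Suc n)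
      define s where "s = ln ((M_D f D ^^ n) \<rho>)"
      have "0 < (M_D f D ^^ n) \<rho>" using Suc by (meson exp_gt_zero less_le_trans)
      then have s: "(M_D f D ^^ n) \<rho> = exp s" by (simp add: s_def)
      have s1: "t1 \<le> s" "s \<le> Re (c n) - 5" using Suc unfolding s by auto
      have "exp t1 \<le> M_D f D (exp s)"
        using ta[of s] s1 by (force simp: t1_def)
      moreover have "M_D f D (exp s) \<le> M_D f D (exp (Re (c n)))"
        using s1 by (intro tb) (auto simp: t1_def)
      ultimately show ?case using nxt(1)[OF c_tc[of n]] by (simp add: s c_Suc)
    qed
    have "(M_D f D ^^ n) \<rho> \<le> norm ((f ^^ n) (exp u0))" for n
    proof -
      obtain u where u: "u \<in> cball (c n) 5" "u0 = P n u" using u0[of n] by (auto simp: K_def)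
      have "\<bar>Re (c n - u)\<bar> \<le> 5" using u(1) abs_Re_le_cmod[of "c n - u"] by (simp add: dist_norm)
      then have "exp (Re (c n) - 5) \<le> exp (Re u)" by simp
      then have "(M_D f D ^^ n) \<rho> \<le> exp (Re u)" using M_le[of n] order_trans by blast
      then show ?thesis using fP[OF u(1)] u(2) by simp
    qed
    then have "exp u0 \<in> A' f D \<rho>"
      unfolding A'_def using inD inD[of 0] by (auto intro!: exI[of _ 0])
    moreover have "u0 \<in> cball c0 5" using u0[of 0] by (simp add: K_def P_0 c_def)
    ultimately show ?thesis by blast
  qed
  then show ?thesis by blast
qed

end

text \<open>The delay in the definition of \<open>A'\<close> absorbs one more step: \<open>L\<close>
  for \<open>f z\<close> becomes \<open>Suc L\<close> for \<open>z\<close>.\<close>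

lemma A'_backward_invariant:
  assumes "z \<in> D" "f z \<in> A' f D \<rho>"
  shows "z \<in> A' f D \<rho>"
proof -
  obtain L where L: "\<And>n. (f ^^ n) (f z) \<in> D" "\<And>n. (M_D f D ^^ n) \<rho> \<le> norm ((f ^^ (n + L)) (f z))"
    using assms(2) by (auto simp: A'_def)
  have Suc: "(f ^^ Suc n) z = (f ^^ n) (f z)" for n
    by (simp add: funpow_swap1)
  have "(f ^^ n) z \<in> D" for n
    using assms(1) L(1) Suc by (cases n) (auto simp del: funpow.simps(2))
  moreover have "(M_D f D ^^ n) \<rho> \<le> norm ((f ^^ (n + Suc L)) z)" for n
    using L(2) by (simp only: add_Suc_right Suc)
  ultimately show ?thesis using assms(1) unfolding A'_def by blast
qed

section \<open>The dimension estimate\<close>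

text \<open>The interval ends before the first index with value above \<open>B\<close> and starts
  after the last earlier index with value at most \<open>A\<close>. The first step beyond
  \<open>A\<close> costs at most 1.\<close>

lemma ex_crossing_interval:
  fixes a :: "nat \<Rightarrow> real"
  assumes "a 0 \<le> A" "A \<le> B" "B < a m" and step: "\<And>k. a (Suc k) - a k \<le> 1"
  obtains i j where "i \<le> j" "\<And>k. k \<in> {i..<j} \<Longrightarrow> A < a k \<and> a k \<le> B" "B - A - 1 \<le> a j - a i"
proof -
  define j where "j = (LEAST j. B < a j)"
  have j: "B < a j" "\<And>k. k < j \<Longrightarrow> a k \<le> B"
    unfolding j_def using LeastI[of "\<lambda>j. B < a j", OF assms(3)] not_less_Least by force+
  have "0 < j" using assms(1,2) j(1) by (cases "j = 0") auto
  define T where "T = {k. k < j \<and> a k \<le> A}"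
  have T: "finite T" "0 \<in> T" using \<open>0 < j\<close> assms(1) by (auto simp: T_def)
  define i where "i = Max T"
  have "i \<in> T" using T Max_in i_def by blast
  then have i: "i < j" "a i \<le> A" by (auto simp: T_def)
  have ub: "k \<le> i" if "k \<in> T" for k using that T(1) by (simp add: i_def)
  show thesis
  proof (rule that[of "Suc i" j])
    show "A < a k \<and> a k \<le> B" if "k \<in> {Suc i..<j}" for k
      using ub[of k] j(2)[of k] that by (force simp: T_def)
    show "B - A - 1 \<le> a j - a (Suc i)" using j(1) i(2) step[of i] by linarith
  qed (use i in auto)
qed

text \<open>The radius 1/4 keeps \<open>ball x (dist x y)\<close> inside \<open>ball j 1\<close>,
  where \<open>exp\<close> is injective, so the univalent lower bound applies.\<close>

lemma exp_locally_expanding: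
  assumes "x \<in> ball j (1/4)" "y \<in> ball j (1/4)" "b \<le> Re x"
  shows "exp b / (12 * pi) * dist x y \<le> dist (exp x) (exp y)"
proof -
  have "ball x (dist x y) \<subseteq> ball j 1"
  proof
    fix z assume "z \<in> ball x (dist x y)"
    then have "dist x z < dist x y" by simp
    then show "z \<in> ball j 1"
      using assms dist_triangle[of j z x] dist_triangle[of x y j] by (simp add: dist_commute)
  qed
  moreover have "inj_on exp (ball j 1)"
    using pi_gt3 by (intro inj_on_subset[OF inj_on_exp_pi[of j]] subset_ball) simp
  ultimately have "norm (deriv exp x) * dist x y \<le> 12 * pi * dist (exp x) (exp y)"
    using assms by (intro univalent_dist_ge[where S="ball j 1"]) (auto intro: holomorphic_intros)
  moreover have "deriv exp x = exp x" by (intro DERIV_imp_deriv DERIV_exp)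
  moreover have "exp b * dist x y \<le> exp (Re x) * dist x y"
    using assms(3) by (intro mult_right_mono) auto
  ultimately show ?thesis by (simp add: field_simps)
qed

context log_coordinates
begin

text \<open>Continuity of the branch carries backward invariance to the closure; as the half-plane
  is open, \<open>u\<close> can be approximated from inside it.\<close>

lemma preimage_closure_mono:
  assumes "u \<in> closure {u. exp u \<in> A' f D \<rho>}" "x0 < Re u"
  shows "\<Phi> (u + 2 * pi * of_int k * \<i>) + 2 * pi * of_int n * \<i> \<in> closure {u. exp u \<in> A' f D \<rho>}"
proof -
  let ?S = "{u. exp u \<in> A' f D \<rho>}" and ?H = "{u. x0 < Re u}"
  let ?G = "\<lambda>u. \<Phi> (u + 2 * pi * of_int k * \<i>) + 2 * pi * of_int n * \<i>"
  have "u \<in> ?H \<inter> closure ?S" using assms by simp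
  then have "u \<in> closure (?H \<inter> ?S)" using open_Int_closure_subset[OF open_halfspace_Re_gt] by blast
  then obtain s where s: "\<And>n. s n \<in> ?H \<inter> ?S" "s \<longlonglongrightarrow> u" unfolding closure_sequential by blast
  have "?G (s i) \<in> ?S" for i
  proof -
    have H: "x0 < Re (s i)" "exp (s i) \<in> A' f D \<rho>" using s(1) by auto
    let ?v = "s i + 2 * pi * of_int k * \<i>"
    have v: "x0 < Re ?v" using H(1) by simp
    have "exp ?v \<in> A' f D \<rho>" using H(2) by (simp only: exp_plus_2pi_int)
    then have "exp (\<Phi> ?v) \<in> A' f D \<rho>"
      using A'_backward_invariant[OF exp_in[OF v]] f_exp[OF v] by metis
    then show ?thesis unfolding mem_Collect_eq exp_plus_2pi_int .
  qed
  moreover have "(\<lambda>i. ?G (s i)) \<longlonglongrightarrow> ?G u"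
  proof -
    have "isCont \<Phi> \<zeta>" if "x0 < Re \<zeta>" for \<zeta>
      using continuous_on_eq_continuous_at[OF open_halfspace_Re_gt] cont that by blast
    then have "isCont \<Phi> (u + 2 * pi * of_int k * \<i>)"
      using assms(2) by simp
    then show ?thesis
      by (intro tendsto_add tendsto_const isCont_tendsto_compose[of _ \<Phi>] s(2))
  qed
  ultimately show ?thesis
    unfolding closure_sequential by (intro exI[of _ "\<lambda>i. ?G (s i)"] conjI allI)
qed

text \<open>The branches act on the rectangle \<open>[b, 9b/8] \<times> [-4\<pi>, 4\<pi>]\<close>. The vertical step
  \<open>10 \<pi>\<close> exceeds its height, so they have disjoint images. As \<open>Re \<Phi>\<close> runs from \<open>b\<close> to
  \<open>9b/8\<close> along the line \<open>Re = b\<close>, the derivatives add up to a multiple of \<open>b\<close>.\<close>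

lemma hausdorff_dim_closure_A':
  "\<exists>t1. \<forall>\<rho>\<ge>exp t1. hausdorff_dim (closure (A' f D \<rho>)) > 1"
proof -
  obtain t1 where t1: "\<And>\<rho> c. exp t1 \<le> \<rho> \<Longrightarrow> t1 \<le> Re c \<Longrightarrow> ln \<rho> \<le> Re c - 5 \<Longrightarrow>
      \<exists>u\<in>cball c 5. exp u \<in> A' f D \<rho>"
    using ex_escaping_point by blast
  obtain s where s: "\<And>x. x0 + 24 * pi \<le> x \<Longrightarrow> Re (\<Phi> (of_real x)) \<le> s + x / 2"
    using Re_real_le by blast
  let ?\<kappa> = koebe_const
  note \<kappa> = koebe_const_pos
  have "hausdorff_dim (closure (A' f D \<rho>)) > 1" if \<rho>: "exp t1 \<le> \<rho>" for \<rho>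
  proof -
    \<comment> \<open>\<open>2 * s \<le> b\<close> makes \<open>Re \<Phi>\<close> at most
      \<open>b\<close> at the real point of the line. The bound with \<open>?\<kappa>\<close> makes
      the crossing long enough for the Lipschitz constants to add up to more than 1.\<close>
    obtain b where b: "t1 \<le> b" "ln \<rho> \<le> b" "2 * s \<le> b" "0 \<le> b" "1000 \<le> b"
      "8 * x0 + 1000 \<le> b" "4 * x0 + 1000 \<le> b" "x0 + 1000 \<le> b" "8 * (6 * pi + 2 + 120 * pi\<^sup>2 * ?\<kappa>\<^sup>2) \<le> b"
      "x0 + 120 * pi\<^sup>2 \<le> b"
    proof -
      define b where "b = Max {t1, ln \<rho>, 2 * s, 0, 1000, 8 * x0 + 1000, 4 * x0 + 1000, x0 + 1000,
         8 * (6 * pi + 2 + 120 * pi\<^sup>2 * ?\<kappa>\<^sup>2), x0 + 120 * pi\<^sup>2}"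
      show thesis by (rule that[of b]; unfold b_def; rule Max_ge; simp)
    qed
    \<comment> \<open>\<open>r\<close> is the distance from the line \<open>Re = b\<close> to the
      boundary of the half-plane. The bounds below put shifted rectangles within
      \<open>r / 4\<close> of their base points, where distortion is controlled, and limit the steps
      of \<open>a\<close> to 1.\<close>
    define r where "r = b - x0"
    have r: "0 < r" "b / 8 + 4 * pi < r / 4" "10 * pi < r / 4" "8 * pi < r" "12 * pi / r * (10 * pi) \<le> 1"
      "24 * pi \<le> r"
    proof -
      show r0: "0 < r" using b by (simp add: r_def)
      show "b / 8 + 4 * pi < r / 4" "10 * pi < r / 4" "8 * pi < r" "24 * pi \<le> r"
        using b pi_less_4 by (auto simp: r_def field_simps)
      have "120 * pi\<^sup>2 \<le> r" using b by (simp add: r_def)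
      then show "12 * pi / r * (10 * pi) \<le> 1"
        using r0 by (simp add: field_simps power2_eq_square)
    qed

    \<comment> \<open>Sample points on the vertical line and distortion around them\<close>
    define p where "p k = b + 2 * pi * of_int (5 * int k) * \<i>" for k :: nat
    have Rep: "Re (p k) = b" for k by (simp add: p_def)
    define Q where "Q = cbox (Complex b (- 4 * pi)) (Complex (9 * b / 8) (4 * pi))"
    have Q: "u \<in> Q \<longleftrightarrow> b \<le> Re u \<and> Re u \<le> 9 * b / 8 \<and> - 4 * pi \<le> Im u \<and> Im u \<le> 4 * pi" for u
      by (auto simp: Q_def in_cbox_complex_iff)
    have QH: "x0 < Re u" if "u \<in> Q" for u using that r(1) by (simp add: Q r_def)
    define v where "v k u = u + 2 * pi * of_int (5 * int k) * \<i>" for k :: nat and u :: complex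
    have Rev: "Re (v k u) = Re u" for k u by (simp add: v_def)
    have vp: "dist (v k u) (p k) < r / 4" if "u \<in> Q" for k u
    proof -
      have "dist (v k u) (p k) = norm (u - b)" by (simp add: v_def p_def dist_norm)
      also have "\<dots> \<le> \<bar>Re (u - b)\<bar> + \<bar>Im (u - b)\<bar>" by (rule cmod_le)
      also have "\<dots> \<le> b / 8 + 4 * pi" using that by (auto simp: Q)
      finally show ?thesis using r(2) by simp
    qed
    have d\<Phi>: "dist (\<Phi> x) (\<Phi> y) \<le> 12 * pi / r * dist x y" if "b \<le> Re x" "b \<le> Re y" for x y
      using that r(1) by (intro dist_le) (auto simp: r_def)
    have holp: "\<Phi> holomorphic_on ball (p k) r" and injp: "inj_on \<Phi> (ball (p k) r)" for k
      using ball_subset[of r "p k"] by (auto simp: Rep r_def intro: holomorphic_on_subset[OF hol] inj_on_subset[OF inj])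
    define d where "d k = norm (deriv \<Phi> (p k))" for k
    have d_pos: "0 < d k" for k
      using holomorphic_injective_imp_regular[OF holp open_ball injp, of "p k" k] r(1) by (simp add: d_def)
    have d_le: "norm (deriv \<Phi> z) \<le> ?\<kappa> * d k" if "dist (p k) z < r / 2" for k z
      using that univalent_deriv_le[OF holp r(1) injp] by (simp add: d_def)
    have d_ge: "d k \<le> ?\<kappa> * norm (deriv \<Phi> z)" if "dist (p k) z < r / 4" for k z
      using that univalent_deriv_ge[OF holp r(1) injp] by (simp add: d_def)
    define a where "a k = Re (\<Phi> (p k))" for k
    have step: "\<bar>a (Suc k) - a k\<bar> \<le> 1 \<and> \<bar>a (Suc k) - a k\<bar> \<le> 10 * pi * ?\<kappa> * d k" for k
    proof -
      have pd: "dist (p (Suc k)) (p k) = 10 * pi"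
      proof -
        have "p (Suc k) - p k = of_real (10 * pi) * \<i>" by (simp add: p_def algebra_simps)
        then show ?thesis by (simp add: dist_norm norm_mult)
      qed
      have 0: "\<bar>a (Suc k) - a k\<bar> \<le> dist (\<Phi> (p (Suc k))) (\<Phi> (p k))"
        unfolding a_def dist_norm by (metis abs_Re_le_cmod minus_complex.simps(1))
      also have "\<dots> \<le> 12 * pi / r * (10 * pi)"
        using d\<Phi>[of "p (Suc k)" "p k"] by (simp add: Rep pd)
      finally have 1: "\<bar>a (Suc k) - a k\<bar> \<le> 1" using r(5) by simp
      have "norm (\<Phi> (p (Suc k)) - \<Phi> (p k)) \<le> (?\<kappa> * d k) * norm (p (Suc k) - p k)"
      proof (rule field_differentiable_bound[where S="ball (p k) (r / 2)"])
        fix z assume z: "z \<in> ball (p k) (r / 2)"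
        then have "z \<in> ball (p k) r" using r(1) by simp
        then show "(\<Phi> has_field_derivative deriv \<Phi> z) (at z within ball (p k) (r / 2))"
          using holomorphic_derivI[OF holp open_ball] DERIV_subset by blast
        show "norm (deriv \<Phi> z) \<le> ?\<kappa> * d k" using z by (intro d_le) simp
      next
        show "p (Suc k) \<in> ball (p k) (r / 2)" "p k \<in> ball (p k) (r / 2)"
          using pd r by (simp_all add: dist_commute)
      qed simp
      then have "\<bar>a (Suc k) - a k\<bar> \<le> (?\<kappa> * d k) * (10 * pi)"
        using 0 pd by (simp add: dist_norm)
      with 1 show ?thesis by (simp add: mult_ac)
    qed
    have a0: "a 0 \<le> b + 3 * pi"
    proof -
      have "Re (\<Phi> (of_real b)) \<le> s + b / 2" using r(6) by (intro s) (simp add: r_def)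
      moreover have "p 0 = of_real b" by (simp add: p_def)
      ultimately show ?thesis unfolding a_def using b(3) pi_gt_zero by (simp only:)
    qed
    obtain m where m: "9 * b / 8 - 3 * pi < a m"
    proof -
      obtain Y where Y: "\<And>y. Y < y \<Longrightarrow> 9 * b / 8 - 3 * pi < Re (\<Phi> (Complex b y))"
        using Re_tendsto_up[of b] r(1) by (auto simp: r_def)
      obtain m where m: "Y < of_nat m" using reals_Archimedean2 by blast
      have "1 * real m \<le> (10 * pi) * real m" using pi_gt3 by (intro mult_right_mono) auto
      with m have "Y < 10 * pi * real m" by linarith
      moreover have "p m = Complex b (10 * pi * real m)" by (simp add: p_def complex_eq_iff)
      ultimately have "9 * b / 8 - 3 * pi < a m" unfolding a_def by (metis Y)
      then show thesis by (rule that)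
    qed
    \<comment> \<open>Over a shifted rectangle \<open>\<Phi>\<close> moves by at most
      \<open>12 * pi / r * (r / 4) = 3 * pi\<close>, so \<open>a k\<close> needs this margin on both
      sides. Vertically, \<open>3 * pi\<close> and the normalisation to at most \<open>pi\<close>
      fill the half-height \<open>4 * pi\<close> of \<open>Q\<close>.\<close>
    have AB: "b + 3 * pi \<le> 9 * b / 8 - 3 * pi" using b pi_less_4 by simp
    obtain i j where ij: "i \<le> j" "\<And>k. k \<in> {i..<j} \<Longrightarrow> b + 3 * pi < a k \<and> a k \<le> 9 * b / 8 - 3 * pi"
      "b / 8 - 6 * pi - 1 \<le> a j - a i"
    proof (rule ex_crossing_interval[OF a0 AB m])
      show "a (Suc k) - a k \<le> 1" for k using step[of k] by linarith
    qed (rule that, auto)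

    \<comment> \<open>The branches and the invariant compact set\<close>
    define K where "K = {i..<j}"
    have tele: "a j - a i = (\<Sum>k\<in>K. a (Suc k) - a k)"
      unfolding K_def using ij(1) by (simp add: sum_Suc_diff')
    have "\<forall>k. \<exists>n::int. \<bar>Im (\<Phi> (p k)) + 2 * pi * of_int n\<bar> \<le> pi" using ex_multiple_2pi by blast
    then obtain n :: "nat \<Rightarrow> int" where n: "\<And>k. \<bar>Im (\<Phi> (p k)) + 2 * pi * of_int (n k)\<bar> \<le> pi" by metis
    define G where "G k u = \<Phi> (v k u) + 2 * pi * of_int (n k) * \<i>" for k u
    have G_Q: "G k u \<in> Q" if k: "k \<in> K" and u: "u \<in> Q" for k u
    proof -
      have "dist (\<Phi> (v k u)) (\<Phi> (p k)) \<le> 12 * pi / r * dist (v k u) (p k)"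
        using u by (intro d\<Phi>) (auto simp: Rev Rep Q)
      also have "\<dots> \<le> 12 * pi / r * (r / 4)"
        using vp[OF u, of k] r(1) by (intro mult_left_mono) auto
      also have "\<dots> = 3 * pi" using r(1) by simp
      finally have "norm (\<Phi> (v k u) - \<Phi> (p k)) \<le> 3 * pi" by (simp add: dist_norm)
      then have "\<bar>Re (\<Phi> (v k u) - \<Phi> (p k))\<bar> \<le> 3 * pi" "\<bar>Im (\<Phi> (v k u) - \<Phi> (p k))\<bar> \<le> 3 * pi"
        using abs_Re_le_cmod abs_Im_le_cmod order_trans by blast+
      then have "\<bar>Re (\<Phi> (v k u)) - a k\<bar> \<le> 3 * pi" "\<bar>Im (\<Phi> (v k u)) - Im (\<Phi> (p k))\<bar> \<le> 3 * pi"
        by (simp_all add: a_def)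
      moreover have "b + 3 * pi < a k \<and> a k \<le> 9 * b / 8 - 3 * pi" using ij(2) k by (simp add: K_def)
      ultimately show ?thesis using n[of k] unfolding Q G_def by simp linarith
    qed
    define X where "X = Q \<inter> closure {u. exp u \<in> A' f D \<rho>}"
    \<comment> \<open>\<open>?\<kappa>\<close> pays for moving the derivative from
      \<open>p k\<close> to another point, \<open>12 * pi\<close> for the univalent lower
      bound.\<close>
    define c where "c k = d k / (12 * pi * ?\<kappa>)" for k
    have compact_X: "compact X" unfolding X_def Q_def by (intro compact_Int_closed) auto
    then obtain J where J: "finite J" "X \<subseteq> (\<Union>x\<in>J. ball x (1/4))"
      by (rule compactE_image[of X X "\<lambda>x. ball x (1/4)"]) force+
    show ?thesis
    proof (rule hausdorff_dim_expanding_image_gt_one[where K=K and G=G and X=X and c=c and h=exp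
          and J=J and P="\<lambda>x. ball x (1/4)" and b="exp b / (12 * pi)"])
      show "2 \<le> card K"
      proof -
        \<comment> \<open>Each step of \<open>a\<close> is at most 1, so a long crossing takes many
          indices.\<close>
        have "a j - a i \<le> (\<Sum>k\<in>K. 1)"
          unfolding tele using step by (intro sum_mono) (meson abs_le_D1)
        then have "b / 8 - 6 * pi - 1 \<le> real (card K)" using ij(3) by simp
        then show ?thesis using b(5) pi_less_4 by linarith
      qed
      show "X \<noteq> {}"
      proof -
        \<comment> \<open>This disc has real parts in \<open>[b, b + 10]\<close> and imaginary parts
          in \<open>[-5, 5]\<close>, so it lies in \<open>Q\<close>.\<close>
        have "\<exists>u\<in>cball (of_real (b + 5)) 5. exp u \<in> A' f D \<rho>" using \<rho> b by (intro t1) auto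
        then obtain u where u: "norm (of_real (b + 5) - u) \<le> 5" "exp u \<in> A' f D \<rho>"
          by (auto simp: dist_norm)
        have "\<bar>Re (of_real (b + 5) - u)\<bar> \<le> 5" "\<bar>Im (of_real (b + 5) - u)\<bar> \<le> 5"
          using u(1) abs_Re_le_cmod abs_Im_le_cmod order_trans by blast+
        then have "u \<in> Q" unfolding Q using b(5) pi_gt3 by simp linarith
        then have "u \<in> X" using u(2) unfolding X_def by (intro IntI subsetD[OF closure_subset]) auto
        then show ?thesis by blast
      qed
      show "G k ` X \<subseteq> X" if "k \<in> K" for k
      proof
        fix w assume "w \<in> G k ` X"
        then obtain u where u: "u \<in> Q" "u \<in> closure {u. exp u \<in> A' f D \<rho>}" "w = G k u"
          by (auto simp: X_def)
        show "w \<in> X" unfolding X_def u(3)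
          using G_Q[OF that u(1)] preimage_closure_mono[OF u(2) QH[OF u(1)], of "5 * int k" "n k"]
          by (simp add: G_def v_def)
      qed
      show "continuous_on X (G k)" for k
        unfolding G_def v_def
        by (intro continuous_intros continuous_on_compose2[OF cont]) (auto simp: X_def dest: QH)
      show "0 < c k" for k unfolding c_def using d_pos \<kappa> by simp
      \<comment> \<open>Taking the point further right as centre keeps the disc of radius
        \<open>dist x y\<close> in the half-plane, as \<open>univalent_dist_ge\<close> requires. The
        other case follows by symmetry.\<close>
      have expand: "c k * dist x y \<le> dist (G k x) (G k y)" if "x \<in> Q" "y \<in> Q" "Re y \<le> Re x" for k x y
      proof -
        have vd: "dist (v k x) (v k y) = dist x y" by (simp add: v_def dist_norm)
        have "dist x y \<le> \<bar>Re (x - y)\<bar> + \<bar>Im (x - y)\<bar>" unfolding dist_norm by (rule cmod_le)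
        also have "\<dots> \<le> Re x - Re y + 8 * pi"
          using that unfolding Q minus_complex.simps by linarith
        also have "\<dots> \<le> Re x - x0" using that(2) r(4) by (simp add: Q r_def)
        finally have "ball (v k x) (dist (v k x) (v k y)) \<subseteq> {\<zeta>. x0 < Re \<zeta>}"
          unfolding vd by (intro ball_subset) (simp add: Rev)
        then have "norm (deriv \<Phi> (v k x)) * dist (v k x) (v k y) \<le> 12 * pi * dist (\<Phi> (v k x)) (\<Phi> (v k y))"
          using that QH by (intro univalent_dist_ge[OF hol inj]) (auto simp: Rev)
        moreover have "dist (G k x) (G k y) = dist (\<Phi> (v k x)) (\<Phi> (v k y))"
          by (simp add: G_def dist_norm)
        ultimately have "norm (deriv \<Phi> (v k x)) * dist x y \<le> 12 * pi * dist (G k x) (G k y)"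
          using vd by simp
        moreover have "d k / ?\<kappa> * dist x y \<le> norm (deriv \<Phi> (v k x)) * dist x y"
          using d_ge[of k "v k x"] vp[OF that(1), of k] \<kappa>
          by (intro mult_right_mono) (simp_all add: dist_commute field_simps)
        ultimately have "d k / ?\<kappa> * dist x y \<le> 12 * pi * dist (G k x) (G k y)" by linarith
        then show ?thesis using \<kappa> by (simp add: c_def field_simps)
      qed
      show "c k * dist x y \<le> dist (G k x) (G k y)" if "x \<in> X" "y \<in> X" for k x y
        using expand[of x y k] expand[of y x k] that by (cases "Re y \<le> Re x") (auto simp: X_def dist_commute)
      show "G k ` X \<inter> G l ` X = {}" if "k \<noteq> l" for k l
      proof (rule ccontr)
        assume "G k ` X \<inter> G l ` X \<noteq> {}"
        then obtain x y where xy: "x \<in> Q" "y \<in> Q" "G k x = G l y" by (auto simp: X_def)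
        then have "exp (\<Phi> (v k x)) = exp (\<Phi> (v l y))"
          using exp_plus_2pi_int unfolding G_def by metis
        then have "v k x = v l y" using inj_onD[OF inj_exp] xy QH by (simp add: Rev)
        then have "Im (v k x) = Im (v l y)" by simp
        then have "Im x - Im y = 10 * pi * of_int (int l - int k)" by (simp add: v_def algebra_simps)
        then have "10 * pi * \<bar>of_int (int l - int k)\<bar> = \<bar>Im x - Im y\<bar>" by (simp add: abs_mult)
        also have "\<dots> \<le> 8 * pi" using xy unfolding Q by linarith
        also have "\<dots> < 10 * pi * 1" using pi_gt_zero by linarith
        finally have "\<bar>of_int (int l - int k)\<bar> < (1::real)"
          by (subst (asm) mult_less_cancel_left_pos) auto
        then have "\<bar>int l - int k\<bar> < 1" by linarith
        then show False using that by simp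
      qed
      show "1 < (\<Sum>k\<in>K. c k)"
      proof -
        \<comment> \<open>The constant is \<open>10 * pi * ?\<kappa>\<close>, comparing a step of
          \<open>a\<close> with \<open>d k\<close>, times \<open>12 * pi * ?\<kappa>\<close>,
          comparing \<open>d k\<close> with \<open>c k\<close>.\<close>
        have "120 * pi\<^sup>2 * ?\<kappa>\<^sup>2 + 1 \<le> a j - a i" using ij(3) b by simp
        also have "\<dots> \<le> (\<Sum>k\<in>K. 10 * pi * ?\<kappa> * d k)"
          unfolding tele using step by (intro sum_mono) (meson abs_le_D1)
        also have "\<dots> = (\<Sum>k\<in>K. 120 * pi\<^sup>2 * ?\<kappa>\<^sup>2 * c k)"
          using \<kappa> by (intro sum.cong) (simp_all add: c_def field_simps power2_eq_square)
        also have "\<dots> = 120 * pi\<^sup>2 * ?\<kappa>\<^sup>2 * (\<Sum>k\<in>K. c k)" by (simp add: sum_distrib_left)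
        finally have "120 * pi\<^sup>2 * ?\<kappa>\<^sup>2 * 1 < 120 * pi\<^sup>2 * ?\<kappa>\<^sup>2 * (\<Sum>k\<in>K. c k)" by linarith
        then show ?thesis using \<kappa> by (subst (asm) mult_less_cancel_left_pos) auto
      qed
      show "exp ` X \<subseteq> closure (A' f D \<rho>)"
      proof -
        have "exp ` closure {u. exp u \<in> A' f D \<rho>} \<subseteq> closure (A' f D \<rho>)"
          using closure_subset by (intro image_closure_subset continuous_intros) auto
        then show ?thesis by (auto simp: X_def)
      qed
      show "exp b / (12 * pi) * dist x y \<le> dist (exp x) (exp y)"
        if "x \<in> X \<inter> ball z (1/4)" "y \<in> X \<inter> ball z (1/4)" for x y z
        using that by (intro exp_locally_expanding[of x z y b]) (auto simp: X_def Q)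
    qed (use J compact_X in \<open>auto simp: K_def intro: continuous_intros\<close>)
  qed
  then show ?thesis by blast
qed

end

theorem theorem6p2:
  fixes f :: "complex \<Rightarrow> complex" and D :: "complex set" and R :: real
  assumes "logarithmic_tract f D R"
  shows "\<exists>\<rho>\<^sub>0>0. \<forall>\<rho>\<ge>\<rho>\<^sub>0. hausdorff_dim (closure (A' f D \<rho>)) > 1"
proof -
  obtain x0 \<Phi> where "log_coordinates f D R x0 \<Phi>"
    using logarithmic_tract_log_coordinates[OF assms] by blast
  then obtain t1 where "\<forall>\<rho>\<ge>exp t1. hausdorff_dim (closure (A' f D \<rho>)) > 1"
    using log_coordinates.hausdorff_dim_closure_A' by blast
  then show ?thesis by (intro exI[of _ "exp t1"]) simp
qed

end
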